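(* Let $N\ge1$ be an integer, let $\{m_j\}_{j=1}^\infty$ be a strictly increasing sequence of positive integers, and let $j_0$ be an integer such that $m_j\le N$ whenever $1\le j\le j_0$. Let $j$ be an integer with $1\le j\le j_0-1$. With $W_j$, $X'=\{\xi_{lm}^N\}$, $\mu_N$, $\varphi_j(\cdot,\xi_{lm}^N)$ and $\psi_j(\cdot,\xi_{lm}^N)$ as defined in the context, the following hold. 1. For every $f\in W_j$ and $\xi_{lm}^N\in X'$: $\langle f,\psi_j(\cdot,\xi_{lm}^N)\rangle=f(\xi_{lm}^N)$ and $\langle f,\psi_j(\cdot,\xi_{lm}^N)\rangle_X=f(\xi_{lm}^N)$. 2. For all $\xi_{lm}^N,\xi_{pq}^N\in X'$ with $\xi_{lm}^N\neq\xi_{pq}^N$: $\langle\varphi_j(\cdot,\xi_{lm}^N),\psi_j(\cdot,\xi_{pq}^N)\rangle=0$ and $\langle\varphi_j(\cdot,\xi_{lm}^N),\psi_j(\cdot,\xi_{pq}^N)\rangle_X=0$. 3. For every $\xi_{lm}^N\in X'$: $\|\psi_j(\cdot,\xi_{lm}^N)\|=\sqrt{m_{j+1}^2-m_j^2}$ and $\psi_j(\xi_{lm}^N,\xi_{lm}^N)=m_{j+1}^2-m_j^2$. 4. For every $\xi_{lm}^N\in X'$: $$\frac{\|\psi_j(\cdot,\xi_{lm}^N)\|}{\psi_j(\xi_{lm}^N,\xi_{lm}^N)}=\frac1{\sqrt{m_{j+1}^2-m_j^2}}=\min\{\|f\|: f\in W_j,\ f(\xi_{lm}^N)=1\}.$$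 5. $\operatorname{span}\{\psi_j(\cdot,\xi_{lm}^N):\xi_{lm}^N\in X'\}=W_j$; and, if $j_0<N$, then $f(\xi)=\langle f,\psi_j(\xi,\cdot)\rangle_X$ for all $f\in W_j$ and $\xi\in\mathbb{S}^2$. 6. The set $\{\sqrt{\mu_N(\xi_{lm}^N)}\,\psi_j(\cdot,\xi_{lm}^N):\xi_{lm}^N\in X'\}$ is a tight frame in $W_j$, i.e. for every $f\in W_j$, $$\|f\|^2=\sum_{l=1}^N\sum_{m=0}^{2N}\mu_N(\xi_{lm}^N)\,|\langle f,\psi_j(\cdot,\xi_{lm}^N)\rangle|^2.$$ 7. If $j_0<N$ and $m_j>1$, then for every $\xi_{lm}^N\in X'$: $\int_{\mathbb{S}^2}\psi_j(\xi,\xi_{lm}^N)\,d\omega(\xi)=0$ and $\int_X\psi_j(\xi,\xi_{lm}^N)\,d\mu_N(\xi)=0$.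
   Context: $\mathbb{S}^2$ is the unit sphere in $\mathbb{R}^3$, with points written $(\sin\theta\cos\varphi,\sin\theta\sin\varphi,\cos\theta)$, $\theta\in[0,\pi]$, $\varphi\in[0,2\pi]$; functions on $\mathbb{S}^2$ are identified with functions of $(\theta,\varphi)$. The normalized integral is $\int_{\mathbb{S}^2}f\,d\omega=\frac1{4\pi}\int_0^{2\pi}\int_0^\pi f(\theta,\varphi)\sin\theta\,d\theta\,d\varphi$, with scalar product $\langle f,g\rangle=\int_{\mathbb{S}^2}f\,\overline g\,d\omega$ and norm $\|f\|=\langle f,f\rangle^{1/2}$ on $L^2(\mathbb{S}^2)$ (complex-valued functions). Spherical functions: for $n\ge 0$ and $-n\le k\le n$, $Y_{nk}(\theta,\varphi)=\sqrt{2n+1}\,P_n^{|k|}(\cos\theta)e^{ik\varphi}$, where $P_n$ is the Legendre polynomial of degree $n$ (with $P_n(1)=1$) and $P_n^{|k|}(x)=\sqrt{\frac{(n-|k|)!}{(n+|k|)!}}\,(1-x^2)^{|k|/2}\frac{d^{|k|}}{dx^{|k|}}P_n(x)$, normalized so that the $Y_{nk}$ are orthonormal for $\langle\cdot,\cdot\rangle$. $\mathcal{H}_n=\operatorname{span}\{Y_{nk}:-n\le k\le n\}$ is the space of spherical harmonics of degree $n$. Nodal points and weights: let $\lambda_1^N,\dots,\lambda_N^N\in(-1,1)$ be the roots of $P_N$, let $l_k^N$ be the Lagrange fundamental polynomials of degree $N-1$ with $l_k^N(\lambda_i^N)=\delta_{ki}$, and let $\mathcal{A}_k^N=\int_{-1}^1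 l_k^N(x)\,dx>0$. Put $\theta_l=\arccos\lambda_l^N$ ($1\le l\le N$), $\varphi_m=\frac{2\pi m}{2N+1}$ ($0\le m\le 2N$), $\xi_{lm}^N=(\sin\theta_l\cos\varphi_m,\sin\theta_l\sin\varphi_m,\cos\theta_l)$, $X'=\{\xi_{lm}^N:1\le l\le N,\ 0\le m\le 2N\}$ (identified with $X=\{(\theta_l,\varphi_m)\}$), and $\mu_N(\xi_{lm}^N)=\frac{\mathcal{A}_l^N}{2(2N+1)}$. The discrete integral is $\int_X F\,d\mu_N=\sum_{l=1}^N\sum_{m=0}^{2N}F(\xi_{lm}^N)\mu_N(\xi_{lm}^N)$, with $\langle f,g\rangle_X=\int_X f\,\overline g\,d\mu_N$. Scaling functions, wavelet spaces and weighted wavelets: $V_j=\bigoplus_{n=0}^{m_j-1}\mathcal{H}_n$ and $W_j=\bigoplus_{n=m_j}^{m_{j+1}-1}\mathcal{H}_n$ is the orthogonal complement of $V_j$ in $V_{j+1}$. For $\xi,\eta\in\mathbb{S}^2$, $$\varphi_j(\xi,\eta)=\sum_{n=0}^{m_j-1}\sum_{k=-n}^n\overline{Y_{nk}(\eta)}\,Y_{nk}(\xi),\qquad \psi_j(\xi,\eta)=\sum_{n=m_j}^{m_{j+1}-1}\sum_{k=-n}^n\overline{Y_{nk}(\eta)}\,Y_{nk}(\xi)=\sum_{n=m_j}^{m_{j+1}-1}(2n+1)P_n(\xi\cdot\eta);$$ both are real-valued. *)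

theory Defs
  imports
    "HOL-Analysis.Analysis"
    "HOL-Computational_Algebra.Polynomial"
    "HOL-Library.Function_Algebras"
begin

section \<open>The sphere and integration\<close>

typedef sphere2 = "sphere (0 :: real^3) 1"
  morphisms vec_of sphere2_of
  by (rule exI[of _ "axis 1 1"]) simp

definition sph_pt :: "real \<Rightarrow> real \<Rightarrow> sphere2" where
  "sph_pt \<theta> \<phi> = sphere2_of (vector [sin \<theta> * cos \<phi>, sin \<theta> * sin \<phi>, cos \<theta>])"

lemma vec_of_sph_pt:
  "vec_of (sph_pt \<theta> \<phi>) = vector [sin \<theta> * cos \<phi>, sin \<theta> * sin \<phi>, cos \<theta>]"
proof -
  have "(sin \<theta> * cos \<phi>)\<^sup>2 + (sin \<theta> * sin \<phi>)\<^sup>2 + (cos \<theta>)\<^sup>2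
          = (sin \<theta>)\<^sup>2 * ((sin \<phi>)\<^sup>2 + (cos \<phi>)\<^sup>2) + (cos \<theta>)\<^sup>2"
    by (simp only: power_mult_distrib distrib_left add_ac)
  then show ?thesis unfolding sph_pt_def
    by (intro sphere2_of_inverse) (simp add: norm_eq_1 inner_vec_def sum_3 flip: power2_eq_square)
qed

definition colat :: "sphere2 \<Rightarrow> real" where
  "colat \<xi> = arccos (vec_of \<xi> $ 3)"

text \<open>The longitude, in \<open>[0, 2\<pi>)\<close>.  It is \<open>0\<close> at the two poles, an arbitrary choice.\<close>

definition longit :: "sphere2 \<Rightarrow> real" where
  "longit \<xi> = Arg2pi (Complex (vec_of \<xi> $ 1) (vec_of \<xi> $ 2))"

definition sph_int :: "(sphere2 \<Rightarrow> complex) \<Rightarrow> complex" where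
  "sph_int f = complex_of_real (1 / (4 * pi)) *
     integral {0..2 * pi} (\<lambda>\<phi>. integral {0..pi} (\<lambda>\<theta>. f (sph_pt \<theta> \<phi>) * complex_of_real (sin \<theta>)))"

definition sph_inner :: "(sphere2 \<Rightarrow> complex) \<Rightarrow> (sphere2 \<Rightarrow> complex) \<Rightarrow> complex" where
  "sph_inner f g = sph_int (\<lambda>\<xi>. f \<xi> * cnj (g \<xi>))"

definition sph_norm :: "(sphere2 \<Rightarrow> complex) \<Rightarrow> real" where
  "sph_norm f = sqrt (Re (sph_inner f f))"


section \<open>Complex linear span of a set of functions\<close>

text \<open>The overloaded \<^const>\<open>span\<close> is the span over the reals.\<close>

definition cfun_scale :: "complex \<Rightarrow> ('a \<Rightarrow> complex) \<Rightarrow> 'a \<Rightarrow> complex" where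
  "cfun_scale c f = (\<lambda>x. c * f x)"

global_interpretation cfun: vector_space "cfun_scale :: complex \<Rightarrow> ('a \<Rightarrow> complex) \<Rightarrow> 'a \<Rightarrow> complex"
  defines cspan = cfun.span
  by unfold_locales (auto simp: cfun_scale_def fun_eq_iff algebra_simps)


section \<open>Spherical harmonics\<close>

text \<open>Rodrigues' formula.\<close>

definition legendre :: "nat \<Rightarrow> real poly" where
  "legendre n = smult (1 / (2 ^ n * fact n)) ((pderiv ^^ n) ([:-1, 0, 1:] ^ n))"

text \<open>
  \<open>(1 - x\<^sup>2)\<^bsup>k/2\<^esup>\<close> is written as a natural power of a square root, because \<open>0 powr 0 = 0\<close>
  would give the wrong value for \<open>k = 0\<close> at \<open>x = 1\<close> and \<open>x = -1\<close>.
\<close>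

definition assoc_legendre :: "nat \<Rightarrow> nat \<Rightarrow> real \<Rightarrow> real" where
  "assoc_legendre n k x =
     sqrt (fact (n - k) / fact (n + k)) * sqrt (1 - x\<^sup>2) ^ k * poly ((pderiv ^^ k) (legendre n)) x"

text \<open>
  At the poles the factor \<open>assoc_legendre n \<bar>k\<bar>\<close> vanishes for \<open>k \<noteq> 0\<close>, so the value does not
  depend on the choice of the longitude there.
\<close>

definition Y :: "nat \<Rightarrow> int \<Rightarrow> sphere2 \<Rightarrow> complex" where
  "Y n k \<xi> = complex_of_real (sqrt (2 * real n + 1) * assoc_legendre n (nat \<bar>k\<bar>) (cos (colat \<xi>)))
               * exp (\<i> * of_int k * complex_of_real (longit \<xi>))"

definition harmonics :: "nat \<Rightarrow> (sphere2 \<Rightarrow> complex) set" where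
  "harmonics n = cspan (Y n ` {- int n..int n})"


section \<open>Nodes, weights and the discrete inner product\<close>

text \<open>
  Throughout, \<open>lam 1, \<dots>, lam N\<close> are the roots of \<^term>\<open>legendre N\<close> in some order.
\<close>

definition lagrange_fund :: "nat \<Rightarrow> (nat \<Rightarrow> real) \<Rightarrow> nat \<Rightarrow> real poly" where
  "lagrange_fund N lam k = (\<Prod>i\<in>{1..N} - {k}. smult (1 / (lam k - lam i)) [:- lam i, 1:])"

lemma poly_lagrange_fund:
  assumes "inj_on lam {1..N}" "k \<in> {1..N}" "i \<in> {1..N}"
  shows "poly (lagrange_fund N lam k) (lam i) = (if k = i then 1 else 0)"
proof (cases "k = i")
  case True
  have "lam i - lam i' \<noteq> 0" if "i' \<in> {1..N} - {i}" for i'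
    using assms that by (auto dest: inj_onD)
  then have "poly (smult (1 / (lam i - lam i')) [:- lam i', 1:]) (lam i) = 1"
    if "i' \<in> {1..N} - {i}" for i'
    using that by (auto simp: divide_simps)
  then have "(\<Prod>i'\<in>{1..N} - {i}. poly (smult (1 / (lam i - lam i')) [:- lam i', 1:]) (lam i)) = 1"
    by (intro prod.neutral) blast
  then show ?thesis using True by (simp only: lagrange_fund_def poly_prod refl if_True)
next
  case False
  then show ?thesis using assms
    by (auto simp: lagrange_fund_def poly_prod intro!: prod_zero bexI[of _ i])
qed

lemma degree_lagrange_fund:
  assumes "inj_on lam {1..N}" "k \<in> {1..N}"
  shows "degree (lagrange_fund N lam k) = N - 1"
proof -
  have "lam k - lam i \<noteq> 0" if "i \<in> {1..N} - {k}" for i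
    using assms that by (auto dest: inj_onD)
  then have "degree (lagrange_fund N lam k) = (\<Sum>i\<in>{1..N} - {k}. 1)"
    unfolding lagrange_fund_def by (subst degree_prod_eq_sum_degree) auto
  then show ?thesis using assms by simp
qed

definition cotes :: "nat \<Rightarrow> (nat \<Rightarrow> real) \<Rightarrow> nat \<Rightarrow> real" where
  "cotes N lam k = integral {-1..1} (poly (lagrange_fund N lam k))"

definition node :: "nat \<Rightarrow> (nat \<Rightarrow> real) \<Rightarrow> nat \<Rightarrow> nat \<Rightarrow> sphere2" where
  "node N lam l i = sph_pt (arccos (lam l)) (2 * pi * real i / (2 * real N + 1))"

definition weight :: "nat \<Rightarrow> (nat \<Rightarrow> real) \<Rightarrow> nat \<Rightarrow> nat \<Rightarrow> real" where
  "weight N lam l i = cotes N lam l / (2 * (2 * real N + 1))"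

definition disc_int :: "nat \<Rightarrow> (nat \<Rightarrow> real) \<Rightarrow> (sphere2 \<Rightarrow> complex) \<Rightarrow> complex" where
  "disc_int N lam F =
     (\<Sum>l = 1..N. \<Sum>i = 0..2 * N. F (node N lam l i) * complex_of_real (weight N lam l i))"

definition disc_inner ::
  "nat \<Rightarrow> (nat \<Rightarrow> real) \<Rightarrow> (sphere2 \<Rightarrow> complex) \<Rightarrow> (sphere2 \<Rightarrow> complex) \<Rightarrow> complex" where
  "disc_inner N lam f g = disc_int N lam (\<lambda>\<xi>. f \<xi> * cnj (g \<xi>))"


section \<open>Scaling functions and wavelets\<close>

definition kernel_sum :: "nat set \<Rightarrow> sphere2 \<Rightarrow> sphere2 \<Rightarrow> complex" where
  "kernel_sum A \<xi> \<eta> = (\<Sum>n\<in>A. \<Sum>k = - int n..int n. cnj (Y n k \<eta>) * Y n k \<xi>)"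

definition scaling_fn :: "(nat \<Rightarrow> nat) \<Rightarrow> nat \<Rightarrow> sphere2 \<Rightarrow> sphere2 \<Rightarrow> complex" where
  "scaling_fn m j = kernel_sum {0..<m j}"

definition wavelet :: "(nat \<Rightarrow> nat) \<Rightarrow> nat \<Rightarrow> sphere2 \<Rightarrow> sphere2 \<Rightarrow> complex" where
  "wavelet m j = kernel_sum {m j..<m (Suc j)}"

text \<open>The sum of the subspaces \<^term>\<open>harmonics n\<close>.\<close>

definition W :: "(nat \<Rightarrow> nat) \<Rightarrow> nat \<Rightarrow> (sphere2 \<Rightarrow> complex) set" where
  "W m j = cspan (\<Union>n\<in>{m j..<m (Suc j)}. harmonics n)"

definition tight_frame :: "(sphere2 \<Rightarrow> complex) set \<Rightarrow> 'i set \<Rightarrow> ('i \<Rightarrow> sphere2 \<Rightarrow> complex) \<Rightarrow> bool" where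
  "tight_frame H I g \<longleftrightarrow> (\<forall>i\<in>I. g i \<in> H) \<and>
     (\<exists>A>0. \<forall>f\<in>H. (\<Sum>i\<in>I. (cmod (sph_inner f (g i)))\<^sup>2) = A * (sph_norm f)\<^sup>2)"

end

theory Submission
  imports Defs
begin

text \<open>
  Both inner products make the \<^term>\<open>Y n k\<close> with \<^term>\<open>n < N\<close> orthonormal.  For the integral this is
  orthogonality of the associated Legendre functions, obtained by descending in \<open>k\<close> with the Legendre
  equation.  For the discrete one, products of two such functions have degree at most \<open>2 * N - 2\<close> in
  \<open>cos \<theta>\<close> and frequency below \<open>2 * N + 1\<close> in \<open>\<phi>\<close>, so Gauss quadrature and the trapezoidal rule are exact.
  Hence the wavelet at \<open>\<eta>\<close> has coefficients \<^term>\<open>cnj (Y n k \<eta>)\<close> and reproduces the value at \<open>\<eta>\<close> for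
  either product, which reduces all assertions to finite sums of coefficients.  The norms come from the diagonal
  case \<open>\<Sum>\<^sub>k |Y n k \<xi>|\<^sup>2 = 2 * n + 1\<close> of the addition theorem, and the minimum property is Cauchy-Schwarz.
\<close>

section \<open>Integrals of polynomials\<close>

definition poly_int :: "real poly \<Rightarrow> real" where
  "poly_int p = integral {-1..1} (poly p)"

lemma poly_integrable: "poly p integrable_on {a..b::real}"
  by (intro integrable_continuous_real continuous_intros)

lemma poly_int_add: "poly_int (p + q) = poly_int p + poly_int q"
  unfolding poly_int_def poly_add by (intro integral_add poly_integrable)

lemma poly_int_smult: "poly_int (smult c p) = c * poly_int p"
  unfolding poly_int_def poly_smult by simp

lemma poly_int_0 [simp]: "poly_int 0 = 0"
  using poly_int_smult[of 0 0] by simp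

lemma poly_int_diff: "poly_int (p - q) = poly_int p - poly_int q"
  using poly_int_add[of "p - q" q] by simp

lemma poly_int_sum: "poly_int (sum f A) = (\<Sum>i\<in>A. poly_int (f i))"
  by (induction A rule: infinite_finite_induct) (auto simp: poly_int_add)

lemma poly_int_pderiv: "poly_int (pderiv p) = poly p 1 - poly p (-1)"
  unfolding poly_int_def
  by (intro integral_unique fundamental_theorem_of_calculus)
    (auto intro!: derivative_eq_intros simp flip: has_real_derivative_iff_has_vector_derivative)

lemma poly_int_by_parts:
  "poly_int (pderiv p * q) = poly (p * q) 1 - poly (p * q) (-1) - poly_int (p * pderiv q)"
  using poly_int_pderiv[of "p * q"] by (simp add: pderiv_mult poly_int_add mult.commute)

lemma poly_antiderivative_exists: "\<exists>q. pderiv q = (p :: real poly)"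
proof
  let ?q = "\<Sum>i\<le>degree p. monom (coeff p i / real (Suc i)) (Suc i)"
  have "pderiv ?q = (\<Sum>i\<le>degree p. pderiv (monom (coeff p i / real (Suc i)) (Suc i)))"
    by (rule higher_pderiv_sum[of 1, simplified])
  also have "\<dots> = (\<Sum>i\<le>degree p. monom (coeff p i) i)"
    by (intro sum.cong) (simp_all add: pderiv_monom del: of_nat_Suc)
  finally show "pderiv ?q = p" by (simp add: poly_as_sum_of_monoms)
qed

text \<open>Substitution \<open>x = cos \<theta>\<close>: if \<open>q\<close> is an antiderivative
  of \<open>p\<close>, then \<open>- poly q (cos \<theta>)\<close> is one of the integrand.\<close>

lemma has_integral_poly_cos:
  "((\<lambda>\<theta>. poly p (cos \<theta>) * sin \<theta>) has_integral poly_int p) {0..pi}"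
proof -
  obtain q where q: "pderiv q = p" using poly_antiderivative_exists by blast
  have "((\<lambda>\<theta>. poly p (cos \<theta>) * sin \<theta>) has_integral (- poly q (cos pi) - - poly q (cos 0))) {0..pi}"
    by (intro fundamental_theorem_of_calculus)
      (auto intro!: derivative_eq_intros simp: q simp flip: has_real_derivative_iff_has_vector_derivative)
  then show ?thesis using poly_int_pderiv[of q] by (simp add: q)
qed

text \<open>A continuous nonnegative function with zero integral vanishes on the interval, which
  would give a nonzero \<open>p\<close> infinitely many roots.\<close>

lemma poly_int_eq_0_nonneg:
  assumes "poly_int p = 0" "\<And>x. x \<in> {-1..1} \<Longrightarrow> poly p x \<ge> 0"
  shows "p = 0"
proof (rule ccontr)
  assume "p \<noteq> 0"
  have "continuous_on {-1..1} (poly p)" by (intro continuous_intros)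
  then have "\<forall>x\<in>{-1..1}. poly p x = 0"
    using assms integral_eq_0_iff[of "-1" 1 "poly p"] by (simp add: poly_int_def)
  then have "{-1..1} \<subseteq> {x. poly p x = 0}" by auto
  with poly_roots_finite[OF \<open>p \<noteq> 0\<close>] have "finite {-1..1 :: real}"
    by (rule rev_finite_subset)
  with infinite_Icc[of "-1" "1::real"] show False by simp
qed

section \<open>Legendre polynomials\<close>

text \<open>One derivative turns \<open>(X - a)^(n+1) q\<close> into \<open>(X - a)^n\<close> times
  a polynomial with value \<open>(n+1) q(a)\<close> at \<open>a\<close>; hence the induction over
  arbitrary \<open>q\<close>. Rodrigues' formula then yields the endpoint values.\<close>

lemma poly_higher_pderiv_linear_power:
  "poly ((pderiv ^^ n) ([:- a, 1:] ^ n * q)) a = fact n * poly q (a::real)"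
proof (induction n arbitrary: q)
  case (Suc n)
  have "pderiv ([:- a, 1:] ^ Suc n * q) =
      [:- a, 1:] ^ n * (smult (real (Suc n)) q + [:- a, 1:] * pderiv q)"
    by (simp add: pderiv_mult pderiv_power_Suc pderiv_pCons algebra_simps del: power_Suc)
      (simp add: algebra_simps)
  then show ?case
    by (simp add: funpow_Suc_right Suc del: funpow.simps power_Suc)
qed simp

lemma quadratic_factor: "[:-1, 0, 1:] = [:-1, 1:] * [:1, 1::real:]"
  by simp

lemma poly_legendre_1: "poly (legendre n) 1 = 1"
  using poly_higher_pderiv_linear_power[of n 1 "[:1,1:] ^ n"]
  by (simp add: legendre_def quadratic_factor power_mult_distrib higher_pderiv_smult del: mult_pCons_left mult_pCons_right)

lemma poly_legendre_minus_1: "poly (legendre n) (-1) = (-1) ^ n"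
  using poly_higher_pderiv_linear_power[of n "-1" "[:-1,1:] ^ n"]
  by (simp add: legendre_def quadratic_factor power_mult_distrib mult.commute[of "[:-1,1:]"] power_minus[of 2] del: mult_pCons_left mult_pCons_right)

lemma poly_higher_pderiv_linear_power_less:
  "k < n \<Longrightarrow> poly ((pderiv ^^ k) ([:- a, 1:] ^ n * q)) a = (0::real)"
proof (induction k arbitrary: q n)
  case (Suc k)
  then obtain n' where n: "n = Suc n'" "k < n'" by (cases n) auto
  have "pderiv ([:- a, 1:] ^ Suc n' * q) =
      [:- a, 1:] ^ n' * (smult (real (Suc n')) q + [:- a, 1:] * pderiv q)"
    by (simp add: pderiv_mult pderiv_power_Suc pderiv_pCons algebra_simps del: power_Suc)
      (simp add: algebra_simps)
  then show ?case
    using Suc.IH[OF n(2)] unfolding n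
    by (simp add: funpow_Suc_right del: funpow.simps power_Suc)
qed (auto simp: zero_power)

text \<open>Each endpoint is a zero of order \<open>n\<close>, so it remains a zero after fewer than
  \<open>n\<close> derivatives. This removes the boundary terms in
  \<open>rodrigues_by_parts\<close>.\<close>

lemma rodrigues_boundary:
  assumes "k < n" "x = 1 \<or> x = -1"
  shows "poly ((pderiv ^^ k) ([:-1, 0, 1:] ^ n)) x = (0::real)"
  using assms poly_higher_pderiv_linear_power_less[of k n 1 "[:1,1:] ^ n"]
    poly_higher_pderiv_linear_power_less[of k n "-1" "[:-1,1:] ^ n"]
  by (auto simp: quadratic_factor power_mult_distrib mult.commute simp del: mult_pCons_left mult_pCons_right)

lemma rodrigues_by_parts:
  "k \<le> n \<Longrightarrow> poly_int ((pderiv ^^ n) ([:-1, 0, 1:] ^ n) * q) =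
     (-1) ^ k * poly_int ((pderiv ^^ (n - k)) ([:-1, 0, 1:] ^ n) * (pderiv ^^ k) q)"
proof (induction k)
  case (Suc k)
  \<comment> \<open>Splits off the derivative to be moved; the boundary terms then carry only
    \<open>n - Suc k < n\<close> derivatives.\<close>
  then have nk: "n - k = Suc (n - Suc k)" by simp
  show ?case
    using Suc rodrigues_boundary[of "n - Suc k" n]
    unfolding nk by (simp add: poly_int_by_parts)
qed simp

lemma higher_pderiv_eq_0: "degree (p :: real poly) < k \<Longrightarrow> (pderiv ^^ k) p = 0"
proof (induction k arbitrary: p)
  case (Suc k)
  show ?case
  proof (cases "degree p = 0")
    case True
    then have "pderiv p = 0" by (simp add: pderiv_eq_0_iff)
    then show ?thesis by (simp add: funpow_Suc_right higher_pderiv_0 del: funpow.simps)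
  next
    case False
    then show ?thesis using Suc by (simp add: funpow_Suc_right degree_pderiv del: funpow.simps)
  qed
qed simp

text \<open>Moving all \<open>n\<close> derivatives of Rodrigues' formula onto \<open>q\<close>
  annihilates it.\<close>

lemma legendre_orthogonal_low_degree:
  assumes "degree q < n"
  shows "poly_int (legendre n * q) = 0"
  using rodrigues_by_parts[of n n q] higher_pderiv_eq_0[OF assms]
  by (simp add: legendre_def poly_int_smult)

lemma degree_legendre: "degree (legendre n) = n"
proof -
  have "degree ([:-1, 0, 1::real:] ^ n) = 2 * n" by (simp add: degree_power_eq)
  then show ?thesis by (simp add: legendre_def degree_higher_pderiv)
qed

lemma legendre_neq_0 [simp]: "legendre n \<noteq> 0"
  using poly_legendre_1[of n] by force

text \<open>
  With \<open>P\<close> the Legendre polynomial, \<open>x P' - n P\<close> has degree below \<open>n\<close>, hence is orthogonal to \<open>P\<close>; integrating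
  \<open>1 \<cdot> P\<^sup>2\<close> by parts then gives \<open>I = 2 - 2 n I\<close> for the squared norm \<open>I\<close>.
\<close>

lemma legendre_norm: "poly_int (legendre n * legendre n) = 2 / (2 * real n + 1)"
proof -
  let ?P = "legendre n" and ?X = "[:0, 1::real:]"
  let ?r = "?X * pderiv ?P - smult (real n) ?P"
  have "poly_int (?P * ?r) = 0"
  proof (cases "n = 0")
    case True
    then have "degree ?P = 0" by (simp add: degree_legendre)
    then have "pderiv ?P = 0" by (simp add: pderiv_eq_0_iff)
    with True show ?thesis by simp
  next
    case False
    \<comment> \<open>The leading terms of \<open>x P'\<close> and \<open>n P\<close>
      cancel.\<close>
    have "coeff ?r i = 0" if "i \<ge> n" for i
      using that False by (cases i) (auto simp: coeff_pCons coeff_pderiv coeff_eq_0 degree_legendre le_Suc_eq le_less algebra_simps)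
    then have "degree ?r \<le> n - 1"
      using False by (intro degree_le) auto
    then show ?thesis using False by (intro legendre_orthogonal_low_degree) linarith
  qed
  then have eq: "poly_int (?P * (?X * pderiv ?P)) = real n * poly_int (?P * ?P)"
    by (simp add: right_diff_distrib poly_int_diff poly_int_smult)
  have "?X * pderiv (?P * ?P) = smult 2 (?P * (?X * pderiv ?P))"
    by (simp add: pderiv_mult algebra_simps flip: poly_eq_poly_eq_iff) (simp add: fun_eq_iff algebra_simps)
  \<comment> \<open>The factor 1 is written as \<open>pderiv ?X\<close>; the boundary terms give 2
    because \<open>P^2 = 1\<close> at both endpoints.\<close>
  then have "poly_int (pderiv ?X * (?P * ?P)) = 2 - 2 * poly_int (?P * (?X * pderiv ?P))"
    unfolding poly_int_by_parts
    using poly_int_smult[of 2 "?P * (?X * pderiv ?P)"]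
    by (simp add: poly_legendre_1 poly_legendre_minus_1 flip: power_mult_distrib)
  then have "poly_int (?P * ?P) = 2 - 2 * real n * poly_int (?P * ?P)"
    unfolding eq by (simp add: pderiv_pCons)
  then show ?thesis by (simp add: field_simps)
qed

section \<open>The Legendre equation and the associated Legendre functions\<close>

text \<open>The polynomial \<open>v = (x^2 - 1)^n\<close> satisfies
  \<open>(x^2 - 1) v' = 2 n x v\<close>; differentiating this \<open>k + 1\<close> times gives the
  recurrence.\<close>

lemma rodrigues_ode:
  "[:-1, 0, 1:] * (pderiv ^^ Suc (Suc k)) ([:-1, 0, 1:] ^ n) =
     smult (2 * (real n - real k - 1)) ([:0, 1:] * (pderiv ^^ Suc k) ([:-1, 0, 1:] ^ n)) +
     smult ((real k + 1) * (2 * real n - real k)) ((pderiv ^^ k) ([:-1, 0, 1:] ^ n))"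
proof (induction k)
  case 0
  have "[:-1, 0, 1:] * pderiv ([:-1, 0, 1:] ^ n) = smult (2 * real n) ([:0, 1:] * [:-1, 0, 1:] ^ n)"
    by (cases n)
      (simp_all add: pderiv_power_Suc pderiv_pCons del: power_Suc flip: poly_eq_poly_eq_iff,
        simp add: fun_eq_iff algebra_simps)
  then have "pderiv ([:-1, 0, 1:] * pderiv ([:-1, 0, 1:] ^ n)) =
      pderiv (smult (2 * real n) ([:0, 1:] * [:-1, 0, 1:] ^ n))" by simp
  then show ?case 
    unfolding pderiv_mult pderiv_smult
    by (simp add: pderiv_pCons flip: poly_eq_poly_eq_iff) (simp add: fun_eq_iff algebra_simps)
next
  case (Suc k)
  from arg_cong[OF Suc, of pderiv] show ?case
    unfolding pderiv_mult pderiv_smult pderiv_add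
    by (simp add: pderiv_pCons flip: poly_eq_poly_eq_iff) (simp add: fun_eq_iff algebra_simps)
qed

text \<open>The case \<open>k + n\<close> of \<open>rodrigues_ode\<close>, rescaled by the constant
  of Rodrigues' formula; \<open>k = 0\<close> is Legendre's equation.\<close>

lemma legendre_ode:
  "(1 - x\<^sup>2) * poly ((pderiv ^^ Suc (Suc k)) (legendre n)) x =
     2 * (real k + 1) * x * poly ((pderiv ^^ Suc k) (legendre n)) x -
     (real n - real k) * (real n + real k + 1) * poly ((pderiv ^^ k) (legendre n)) x"
proof -
  have "(pderiv ^^ i) (legendre n) =
      smult (1 / (2 ^ n * fact n)) ((pderiv ^^ (i + n)) ([:-1, 0, 1:] ^ n))" for i
    by (simp add: legendre_def higher_pderiv_smult funpow_add)
  moreover have "poly ([:-1, 0, 1:] * (pderiv ^^ Suc (Suc (k + n))) ([:-1, 0, 1:] ^ n)) x =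
     poly (smult (2 * (real n - real (k + n) - 1)) ([:0, 1:] * (pderiv ^^ Suc (k + n)) ([:-1, 0, 1:] ^ n)) +
     smult ((real (k + n) + 1) * (2 * real n - real (k + n))) ((pderiv ^^ (k + n)) ([:-1, 0, 1:] ^ n))) x"
    by (simp only: rodrigues_ode)
  moreover define c R0 R1 R2 where "c = 1 / (2 ^ n * fact n :: real)"
    and "R0 = poly ((pderiv ^^ (k + n)) ([:-1, 0, 1:] ^ n)) x"
    and "R1 = poly ((pderiv ^^ Suc (k + n)) ([:-1, 0, 1:] ^ n)) x"
    and "R2 = poly ((pderiv ^^ Suc (Suc (k + n))) ([:-1, 0, 1:] ^ n)) x"
  ultimately have "(x\<^sup>2 - 1) * R2 = 2 * (- real k - 1) * x * R1 + (real k + real n + 1) * (real n - real k) * R0"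
    and P: "poly ((pderiv ^^ k) (legendre n)) x = c * R0"
      "poly ((pderiv ^^ Suc k) (legendre n)) x = c * R1"
      "poly ((pderiv ^^ Suc (Suc k)) (legendre n)) x = c * R2"
    by (simp_all add: power2_eq_square algebra_simps del: funpow.simps)
  then show ?thesis unfolding P by algebra
qed

text \<open>The self-adjoint form of \<open>legendre_ode\<close>, ready for integration by
  parts.\<close>

lemma pderiv_weighted_legendre:
  "pderiv ([:1, 0, -1:] ^ Suc k * (pderiv ^^ Suc k) (legendre n)) =
     smult (- (real n - real k) * (real n + real k + 1))
       ([:1, 0, -1:] ^ k * (pderiv ^^ k) (legendre n))"
proof -
  have "poly (pderiv ([:1, 0, -1:] ^ Suc k * (pderiv ^^ Suc k) (legendre n))) x =
      poly (smult (- (real n - real k) * (real n + real k + 1))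
        ([:1, 0, -1:] ^ k * (pderiv ^^ k) (legendre n))) x" for x
  proof -
    have "poly (pderiv ([:1, 0, -1:] ^ Suc k * (pderiv ^^ Suc k) (legendre n))) x =
      (1 - x\<^sup>2) ^ k * ((1 - x\<^sup>2) * poly ((pderiv ^^ Suc (Suc k)) (legendre n)) x
        - 2 * (real k + 1) * x * poly ((pderiv ^^ Suc k) (legendre n)) x)"
      unfolding pderiv_mult pderiv_power_Suc
      by (simp add: pderiv_pCons power2_eq_square del: power_Suc) (simp add: algebra_simps)
    then show ?thesis unfolding legendre_ode
      by (simp add: power2_eq_square algebra_simps del: power_Suc funpow.simps)
  qed
  then show ?thesis by (rule poly_ext)
qed

text \<open>One integration by parts lowers \<open>k\<close>; the weight \<open>1 - x^2\<close>
  vanishes at both endpoints, so no boundary terms remain.\<close>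

lemma weighted_legendre_step:
  "poly_int ([:1, 0, -1:] ^ Suc k * (pderiv ^^ Suc k) (legendre n) * (pderiv ^^ Suc k) q) =
    (real n - real k) * (real n + real k + 1) *
      poly_int ([:1, 0, -1:] ^ k * (pderiv ^^ k) (legendre n) * (pderiv ^^ k) q)"
  using poly_int_by_parts[of "[:1, 0, -1:] ^ Suc k * (pderiv ^^ Suc k) (legendre n)" "(pderiv ^^ k) q"]
  unfolding pderiv_weighted_legendre
  by (simp add: poly_int_smult zero_power algebra_simps del: mult_pCons_left)

lemma legendre_orthogonal: "poly_int (legendre n * legendre n') = (if n = n' then 2 / (2 * real n + 1) else 0)"
  using legendre_orthogonal_low_degree[of "legendre n" n'] legendre_orthogonal_low_degree[of "legendre n'" n]
  by (auto simp: degree_legendre legendre_norm linorder_neq_iff mult.commute)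

lemma assoc_legendre_orthogonal:
  assumes "k \<le> n" "k \<le> n'"
  shows "poly_int ([:1, 0, -1:] ^ k * (pderiv ^^ k) (legendre n) * (pderiv ^^ k) (legendre n')) =
    (if n = n' then fact (n + k) / fact (n - k) * (2 / (2 * real n + 1)) else 0)"
  using assms
proof (induction k)
  case 0
  then show ?case by (simp add: legendre_orthogonal)
next
  case (Suc k)
  then have "n - k = Suc (n - Suc k)" by simp
  then have f: "fact (n - k) = (real n - real k) * fact (n - Suc k)"
    using Suc.prems by simp
  have nk: "real n - real k \<noteq> 0" using Suc.prems by simp
  \<comment> \<open>The factor gained from \<open>k\<close> to \<open>k + 1\<close> is the quotient
    of consecutive factorial ratios.\<close>
  have "(real n - real k) * (real n + real k + 1) * (fact (n + k) / fact (n - k) * c) =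
      fact (n + Suc k) / fact (n - Suc k) * c" for c :: real
    unfolding f using nk by (simp add: field_simps)
  note * = this[of "2 / (2 * real n + 1)"]
  have IH: "poly_int ([:1, 0, -1:] ^ k * (pderiv ^^ k) (legendre n) * (pderiv ^^ k) (legendre n')) =
      (if n = n' then fact (n + k) / fact (n - k) * (2 / (2 * real n + 1)) else 0)"
    using Suc by simp
  show ?case
  proof (cases "n = n'")
    case True
    then show ?thesis unfolding weighted_legendre_step IH if_P[OF True] by (intro *)
  next
    case False
    then show ?thesis unfolding weighted_legendre_step IH by simp
  qed
qed

section \<open>Gauss quadrature\<close>

lemma poly_eq_0_all_derivs:
  "(\<And>k. poly ((pderiv ^^ k) p) a = 0) \<Longrightarrow> p = (0 :: real poly)"
proof (induction "degree p" arbitrary: p rule: less_induct)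
  case less
  have *: "poly ((pderiv ^^ k) (pderiv p)) a = 0" for k
    using less.prems[of "Suc k"] by (simp add: funpow_Suc_right del: funpow.simps)
  have "degree p = 0"
  proof (rule ccontr)
    assume "degree p \<noteq> 0"
    then have "pderiv p = 0" by (intro less.hyps *) (simp add: degree_pderiv)
    with \<open>degree p \<noteq> 0\<close> show False by (simp add: pderiv_eq_0_iff)
  qed
  then obtain c where "p = [:c:]" by (rule degree_eq_zeroE)
  with less.prems[of 0] show ?case by simp
qed

text \<open>Since \<open>1 - a^2\<close> is nonzero, the Legendre equation determines each
  derivative at \<open>a\<close> from the two before it. A double root would make all of them
  vanish.\<close>

lemma legendre_root_simple:
  assumes "poly (legendre n) a = 0" "a \<in> {-1<..<1}"
  shows "poly (pderiv (legendre n)) a \<noteq> 0"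
proof
  assume d: "poly (pderiv (legendre n)) a = 0"
  have a: "1 - a\<^sup>2 \<noteq> 0"
    using assms(2) by (auto simp: power2_eq_1_iff)
  have "poly ((pderiv ^^ k) (legendre n)) a = 0 \<and> poly ((pderiv ^^ Suc k) (legendre n)) a = 0" for k
  proof (induction k)
    case (Suc k)
    then show ?case using legendre_ode[of a k n] a by (simp del: funpow.simps)
  qed (use d assms in simp)
  then have "legendre n = 0" by (intro poly_eq_0_all_derivs) blast
  then show False by simp
qed

lemma poly_no_root_same_sign:
  fixes p :: "real poly"
  assumes "\<And>x. x \<in> {a<..<b} \<Longrightarrow> poly p x \<noteq> 0" "x \<in> {a<..<b}" "y \<in> {a<..<b}"
  shows "poly p x * poly p y > 0"
proof -
  have *: "poly p x * poly p y > 0" if "x < y" "x \<in> {a<..<b}" "y \<in> {a<..<b}" for x y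
  proof (rule ccontr)
    assume "\<not> poly p x * poly p y > 0"
    moreover have "poly p x * poly p y \<noteq> 0" using assms(1) that by simp
    ultimately have "poly p x * poly p y < 0" by linarith
    from poly_IVT[OF \<open>x < y\<close> this] that assms(1) show False by auto
  qed
  from assms(1)[OF assms(2)] have "poly p x * poly p x > 0"
    by (metis not_real_square_gt_zero)
  with *[of x y] *[of y x] assms(2,3) show ?thesis
    by (metis linorder_less_linear mult.commute)
qed

lemma prod_linear_dvd:
  fixes p :: "real poly"
  assumes "finite R" "\<And>r. r \<in> R \<Longrightarrow> poly p r = 0"
  shows "(\<Prod>r\<in>R. [:- r, 1:]) dvd p"
  using assms
proof (induction R)
  case (insert r R)
  then obtain s where s: "p = (\<Prod>r\<in>R. [:- r, 1:]) * s" by (auto simp: dvd_def)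
  have "poly (\<Prod>r\<in>R. [:- r, 1:]) r \<noteq> 0"
    using insert by (auto simp: poly_prod)
  moreover have "poly p r = 0" using insert by simp
  ultimately have "poly s r = 0" using s by simp
  then obtain t where "s = [:- r, 1:] * t" by (auto simp: poly_eq_0_iff_dvd dvd_def)
  then have "p = (\<Prod>r\<in>insert r R. [:- r, 1:]) * t" 
    unfolding s \<open>s = [:- r, 1:] * t\<close> prod.insert[OF insert(1,2)] by (simp only: mult_ac)
  then show ?case by simp
qed simp

text \<open>
  Dividing by the product \<open>q\<close> of its (simple) roots in the open interval leaves a factor of constant sign
  there, so the Legendre polynomial is not orthogonal to \<open>q\<close>, and \<open>q\<close> has degree at least \<open>n\<close>.
\<close>

lemma card_legendre_roots_inside:
  "n \<le> card {x \<in> {-1<..<1}. poly (legendre n) x = 0}"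
proof (rule ccontr)
  define R where "R = {x \<in> {-1<..<1}. poly (legendre n) x = 0}"
  define q where "q = (\<Prod>r\<in>R. [:- r, 1:])"
  assume "\<not> n \<le> card {x \<in> {-1<..<1}. poly (legendre n) x = 0}"
  then have less: "card R < n" by (simp add: R_def)
  have fin: "finite R" unfolding R_def
    by (rule finite_subset[OF _ poly_roots_finite[OF legendre_neq_0[of n]]]) auto
  obtain s where s: "legendre n = q * s"
    using prod_linear_dvd[OF fin, of "legendre n"] by (auto simp: dvd_def q_def R_def)
  have "degree q = card R" unfolding q_def
    by (subst degree_prod_eq_sum_degree) auto
  with less have 0: "poly_int (legendre n * q) = 0"
    by (intro legendre_orthogonal_low_degree) simp
  \<comment> \<open>All interior roots already occur in \<open>q\<close>, so a root of
    \<open>s\<close> there would be a double root.\<close>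
  have s0: "poly s x \<noteq> 0" if "x \<in> {-1<..<1}" for x
  proof
    assume "poly s x = 0"
    moreover from this that have "x \<in> R" by (auto simp: R_def s)
    ultimately have "poly q x = 0" "poly (legendre n) x = 0" "poly (pderiv (legendre n)) x = 0"
      using fin by (auto simp: s q_def poly_prod pderiv_mult)
    with legendre_root_simple that show False by blast
  qed
  \<comment> \<open>A sample value fixing the sign of \<open>s\<close>: \<open>c * s\<close> is
    positive on the open interval.\<close>
  define c where "c = poly s 0"
  have pos: "poly (smult c s * q\<^sup>2) x \<ge> 0" if "x \<in> {-1..1}" for x
  proof -
    have "c * poly s x \<ge> 0" if "x \<in> {-1<..<1}" for x
      using poly_no_root_same_sign[of "-1" 1 s 0 x] s0 that by (auto simp: c_def)
    then have "poly (smult c s) x \<ge> 0" if "x \<in> {-1<..<1}" for x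
      using that by simp
    \<comment> \<open>Closedness carries the weak inequality to the endpoints.\<close>
    moreover have "closed {x. poly (smult c s) x \<ge> 0}"
      by (intro closed_Collect_le continuous_intros)
    ultimately have "closure {-1<..<1} \<subseteq> {x. poly (smult c s) x \<ge> 0}"
      by (intro closure_minimal) auto
    then have "c * poly s x \<ge> 0" using that by auto
    then have "c * poly s x * (poly q x)\<^sup>2 \<ge> 0" by simp
    then show ?thesis by (simp add: mult.assoc)
  qed
  have "smult c s * q\<^sup>2 = smult c (legendre n * q)"
    by (simp add: s power2_eq_square mult_ac)
  then have "poly_int (smult c s * q\<^sup>2) = 0" using 0 by (simp add: poly_int_smult)
  then have "smult c s * q\<^sup>2 = 0" using pos by (rule poly_int_eq_0_nonneg)
  moreover have "c \<noteq> 0" using s0[of 0] by (simp add: c_def)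
  moreover have "s \<noteq> 0" using s legendre_neq_0[of n] by force
  ultimately have "q = 0" by simp
  then show False using s legendre_neq_0[of n] by simp
qed

text \<open>There are at least \<open>N\<close> interior roots, and \<open>lam\<close> has at most
  \<open>N\<close> values; equality must hold throughout.\<close>

lemma legendre_nodes:
  assumes "lam ` {1..N} = {x. poly (legendre N) x = 0}"
  shows "inj_on lam {1..N}" "\<And>l. l \<in> {1..N} \<Longrightarrow> lam l \<in> {-1<..<1}"
proof -
  let ?R = "{x \<in> {-1<..<1}. poly (legendre N) x = 0}"
  have le: "card (lam ` {1..N}) \<le> N" using card_image_le[of "{1..N}" lam] by simp
  have sub: "?R \<subseteq> lam ` {1..N}" using assms by auto
  have "card ?R \<le> card (lam ` {1..N})" by (intro card_mono sub) simp
  with le card_legendre_roots_inside[of N] have eq: "card (lam ` {1..N}) = N" "card ?R = N" by auto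
  then show "inj_on lam {1..N}" by (intro eq_card_imp_inj_on) auto
  have "?R = lam ` {1..N}" by (intro card_subset_eq sub) (use eq in auto)
  then show "lam l \<in> {-1<..<1}" if "l \<in> {1..N}" for l using that by blast
qed

section \<open>Exactness of the quadrature rule and sign of its weights\<close>

text \<open>Division by \<open>legendre N\<close> leaves a quotient of degree below
  \<open>N\<close>, which is orthogonal to it, and a remainder that agrees with \<open>p\<close> at
  the nodes and equals its Lagrange interpolant.\<close>

lemma gauss_quadrature:
  assumes roots: "lam ` {1..N} = {x. poly (legendre N) x = 0}" and deg: "degree p < 2 * N"
  shows "poly_int p = (\<Sum>l = 1..N. cotes N lam l * poly p (lam l))"
proof -
  note inj = legendre_nodes(1)[OF roots]
  let ?q = "p div legendre N" and ?r = "p mod legendre N"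
  have r: "degree ?r < N"
    using deg degree_mod_less'[of "legendre N" p] by (cases "?r = 0") (auto simp: degree_legendre)
  have "poly_int (legendre N * ?q) = 0"
  proof (cases "?q = 0")
    case False
    have "degree (legendre N * ?q) \<le> max (degree p) (degree ?r)"
      using degree_diff_le_max[of p ?r] by (simp add: minus_mod_eq_mult_div)
    then have "degree ?q < N" 
      using deg r False by (simp add: degree_mult_eq degree_legendre)
    then show ?thesis by (rule legendre_orthogonal_low_degree)
  qed simp
  then have p: "poly_int p = poly_int ?r"
    using poly_int_add[of "legendre N * ?q" ?r] by simp
  have pr: "poly p (lam l) = poly ?r (lam l)" if "l \<in> {1..N}" for l
  proof -
    have "poly (legendre N) (lam l) = 0" using roots that by auto
    then have "poly (legendre N * ?q + ?r) (lam l) = poly ?r (lam l)"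
      unfolding poly_add poly_mult by simp
    then show ?thesis by (simp only: mult_div_mod_eq)
  qed
  have "?r = (\<Sum>l = 1..N. smult (poly ?r (lam l)) (lagrange_fund N lam l))" (is "_ = ?s")
  proof (rule poly_eqI_degree[where A = "lam ` {1..N}"])
    show "poly ?r x = poly ?s x" if "x \<in> lam ` {1..N}" for x
      using that by (auto simp: poly_sum poly_lagrange_fund[OF inj] if_distrib cong: if_cong)
    have "degree ?s \<le> N - 1"
      by (intro degree_sum_le order.trans[OF degree_smult_le]) (auto simp: degree_lagrange_fund[OF inj])
    then show "degree ?s < card (lam ` {1..N})" "degree ?r < card (lam ` {1..N})"
      using r card_image[OF inj] by simp_all
  qed
  then have "poly_int ?r = poly_int ?s" by simp
  also have "\<dots> = (\<Sum>l = 1..N. cotes N lam l * poly ?r (lam l))"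
    unfolding poly_int_sum poly_int_smult by (simp add: cotes_def poly_int_def mult.commute)
  finally show ?thesis using p pr by simp
qed

text \<open>The square of a fundamental polynomial still lies within the degree of exactness.\<close>

lemma cotes_nonneg:
  assumes roots: "lam ` {1..N} = {x. poly (legendre N) x = 0}" and "k \<in> {1..N}"
  shows "cotes N lam k \<ge> 0"
proof -
  note inj = legendre_nodes(1)[OF roots]
  let ?l = "lagrange_fund N lam k"
  have "degree (?l\<^sup>2) < 2 * N"
    using degree_power_le[of ?l 2] assms by (auto simp: degree_lagrange_fund[OF inj])
  then have "poly_int (?l\<^sup>2) = (\<Sum>l = 1..N. cotes N lam l * (poly ?l (lam l))\<^sup>2)"
    by (simp add: gauss_quadrature[OF roots])
  also have "\<dots> = (\<Sum>l = 1..N. cotes N lam l * (if k = l then 1 else 0))"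
    using assms by (intro sum.cong) (simp_all add: poly_lagrange_fund[OF inj])
  also have "\<dots> = cotes N lam k" using assms by (simp add: if_distrib cong: if_cong)
  finally have "cotes N lam k = poly_int (?l\<^sup>2)" ..
  then show ?thesis unfolding poly_int_def by (auto intro!: integral_nonneg poly_integrable)
qed

section \<open>Orthonormality of the spherical functions\<close>

text \<open>For \<open>0 < |k| < M\<close> this is a geometric sum over an \<open>M\<close>-th root
  of unity other than 1. It expresses the exactness of the trapezoidal rule.\<close>

lemma sum_roots_of_unity:
  assumes "\<bar>k\<bar> < int M"
  shows "(\<Sum>i<M. exp (\<i> * of_int k * complex_of_real (2 * pi * real i / real M))) =
    (if k = 0 then of_nat M else 0)"
proof (cases "k = 0")
  case False
  let ?z = "exp (\<i> * of_int k * complex_of_real (2 * pi / real M))"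
  have M: "M > 0" using assms by auto
  have e: "exp (\<i> * of_int k * complex_of_real (2 * pi * real i / real M)) = ?z ^ i" for i
    by (simp add: field_simps flip: exp_of_nat_mult)
  have "?z ^ M = exp (of_int k * (of_real (2 * pi) * \<i>))"
    using M by (simp add: field_simps flip: exp_of_nat_mult)
  also have "\<dots> = 1" by (simp add: exp_eq_1)
  finally have "?z ^ M = 1" .
  moreover have "?z \<noteq> 1"
  proof
    assume "?z = 1"
    then obtain t :: int where "real_of_int k * (2 * pi / real M) = of_int (2 * t) * pi"
      by (auto simp: exp_eq_1)
    then have "real_of_int k = of_int (t * int M)" using M by (simp add: field_simps)
    then have "k = t * int M" by (simp only: of_int_eq_iff)
    with assms False show False by (auto simp: abs_mult)
  qed
  ultimately show ?thesis using False unfolding e by (simp add: geometric_sum)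
qed simp

lemma has_integral_exp_int:
  "((\<lambda>\<phi>. exp (\<i> * of_int k * complex_of_real \<phi>)) has_integral (if k = 0 then of_real (2 * pi) else 0)) {0..2 * pi}"
proof (cases "k = 0")
  case True
  then show ?thesis using has_integral_const_real[of "1::complex" 0 "2 * pi"] by (simp add: scaleR_conv_of_real)
next
  case False
  let ?F = "\<lambda>\<phi>. exp (\<i> * of_int k * complex_of_real \<phi>) / (\<i> * of_int k)"
  have "((\<lambda>\<phi>. exp (\<i> * of_int k * complex_of_real \<phi>)) has_integral (?F (2 * pi) - ?F 0)) {0..2 * pi}"
    using False
    by (intro fundamental_theorem_of_calculus)
      (auto intro!: derivative_eq_intros has_vector_derivative_real_field)
  moreover have "exp (\<i> * of_int k * complex_of_real (2 * pi)) = 1"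
    by (simp add: exp_eq_1)
  ultimately show ?thesis using False by simp
qed

definition Y_polar :: "nat \<times> int \<Rightarrow> real \<Rightarrow> real" where
  "Y_polar p x = sqrt (2 * real (fst p) + 1) * assoc_legendre (fst p) (nat \<bar>snd p\<bar>) x"

definition Y_azimuth :: "nat \<times> int \<Rightarrow> real \<Rightarrow> complex" where
  "Y_azimuth p \<phi> = exp (\<i> * of_int (snd p) * of_real \<phi>)"

abbreviation Yp :: "nat \<times> int \<Rightarrow> sphere2 \<Rightarrow> complex" where
  "Yp p \<equiv> Y (fst p) (snd p)"

text \<open>Pairs of degree and order turn the double sums over spherical functions into single
  sums.\<close>

definition harmonic_indices :: "nat set \<Rightarrow> (nat \<times> int) set" where
  "harmonic_indices A = Sigma A (\<lambda>n. {- int n..int n})"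

lemma finite_harmonic_indices [simp]: "finite A \<Longrightarrow> finite (harmonic_indices A)"
  by (simp add: harmonic_indices_def)

text \<open>Away from the poles the longitude equals \<open>\<phi>\<close> modulo
  \<open>2 pi\<close>, which an integer frequency does not detect. At a pole both sides vanish for
  nonzero order and have no azimuthal dependence for order 0.\<close>

lemma Yp_sph_pt:
  assumes "\<theta> \<in> {0..pi}"
  shows "Yp p (sph_pt \<theta> \<phi>) = of_real (Y_polar p (cos \<theta>)) * Y_azimuth p \<phi>"
proof (cases "sin \<theta> = 0")
  case True
  then have c: "1 - (cos \<theta>)\<^sup>2 = 0" by (simp add: sin_squared_eq[symmetric])
  show ?thesis
  proof (cases "snd p = 0")
    case False
    then show ?thesis using assms
      by (simp add: Y_def Y_polar_def assoc_legendre_def colat_def vec_of_sph_pt arccos_cos c zero_power)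
  qed (use assms in \<open>simp add: Y_def Y_polar_def Y_azimuth_def colat_def vec_of_sph_pt arccos_cos\<close>)
next
  case False
  then have s: "sin \<theta> > 0" using assms sin_ge_zero[of \<theta>] by auto
  have "Complex (sin \<theta> * cos \<phi>) (sin \<theta> * sin \<phi>) = of_real (sin \<theta>) * exp (\<i> * of_real \<phi>)"
    by (simp add: complex_eq_iff Re_exp Im_exp)
  then have "exp (\<i> * of_real (longit (sph_pt \<theta> \<phi>))) = exp (\<i> * of_real \<phi>)"
    using Arg2pi_eq[of "of_real (sin \<theta>) * exp (\<i> * of_real \<phi>)"] s
    by (simp add: longit_def vec_of_sph_pt norm_mult)
  then have "exp (of_int (snd p) * (\<i> * of_real (longit (sph_pt \<theta> \<phi>)))) = exp (of_int (snd p) * (\<i> * of_real \<phi>))"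
    by (simp only: exp_power_int[symmetric])
  then show ?thesis using assms
    by (simp add: Y_def Y_polar_def Y_azimuth_def colat_def vec_of_sph_pt arccos_cos mult_ac)
qed

lemma cnj_Yp: "cnj (Yp p \<xi>) = Yp (fst p, - snd p) \<xi>"
  by (simp add: Y_def exp_cnj)

lemma Y_azimuth_mult_cnj: "Y_azimuth p \<phi> * cnj (Y_azimuth q \<phi>) = exp (\<i> * of_int (snd p - snd q) * of_real \<phi>)"
  by (simp add: Y_azimuth_def exp_cnj exp_add[symmetric] algebra_simps)

text \<open>The product of two polar factors of equal order: the square roots of
  \<open>1 - x^2\<close> pair up, which makes it a polynomial.\<close>

definition polar_poly :: "nat \<Rightarrow> nat \<Rightarrow> nat \<Rightarrow> real poly" where
  "polar_poly n n' k = smult (sqrt ((2 * real n + 1) * (2 * real n' + 1) *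
      (fact (n - k) / fact (n + k)) * (fact (n' - k) / fact (n' + k))))
    ([:1, 0, -1:] ^ k * (pderiv ^^ k) (legendre n) * (pderiv ^^ k) (legendre n'))"

lemma polar_poly:
  assumes "\<bar>k\<bar> = \<bar>k'\<bar>" "\<bar>x\<bar> \<le> 1"
  shows "Y_polar (n, k) x * Y_polar (n', k') x = poly (polar_poly n n' (nat \<bar>k\<bar>)) x"
proof -
  have "1 - x\<^sup>2 \<ge> 0" using assms(2) by (simp add: abs_square_le_1)
  then have "sqrt (1 - x\<^sup>2) ^ i * sqrt (1 - x\<^sup>2) ^ i = (1 - x\<^sup>2) ^ i" for i
    by (simp flip: power_mult_distrib)
  then show ?thesis
    by (simp add: Y_polar_def assoc_legendre_def polar_poly_def assms(1) real_sqrt_mult real_sqrt_divide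
        mult_ac flip: power2_eq_square)
qed

lemma poly_int_polar_poly:
  assumes "k \<le> n" "k \<le> n'"
  shows "poly_int (polar_poly n n' k) = (if n = n' then 2 else 0)"
proof (cases "n = n'")
  case True
  \<comment> \<open>For equal degrees the radicand is a perfect square, inverse to the norm up to
    the factor 2.\<close>
  have "poly_int (polar_poly n n k) = sqrt (((2 * real n + 1) * (fact (n - k) / fact (n + k)))\<^sup>2) *
      (fact (n + k) / fact (n - k) * (2 / (2 * real n + 1)))"
    unfolding polar_poly_def poly_int_smult assoc_legendre_orthogonal[OF assms(1) assms(1)]
    by (simp add: power2_eq_square mult_ac)
  also have "\<dots> = 2"
    unfolding real_sqrt_abs by (simp add: abs_mult add_nonneg_pos)
  finally show ?thesis using True by simp
next
  case False
  then show ?thesis using assms by (simp add: polar_poly_def poly_int_smult assoc_legendre_orthogonal)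
qed

text \<open>The weight adds \<open>2 k\<close> and each derivative removes \<open>k\<close>. For
  degrees below \<open>N\<close> the bound is thus at most \<open>2 N - 2\<close>, within the reach
  of Gauss quadrature.\<close>

lemma degree_polar_poly:
  assumes "k \<le> n" "k \<le> n'"
  shows "degree (polar_poly n n' k) \<le> n + n'"
proof -
  have "degree ([:1, 0, -1 :: real:] ^ k) \<le> 2 * k"
    using degree_power_le[of "[:1, 0, -1 :: real:]" k] by simp
  then have "degree ([:1, 0, -1:] ^ k * (pderiv ^^ k) (legendre n) * (pderiv ^^ k) (legendre n'))
      \<le> 2 * k + (n - k) + (n' - k)"
    by (intro order.trans[OF degree_mult_le] add_mono) (auto simp: degree_higher_pderiv degree_legendre)
  then show ?thesis using assms unfolding polar_poly_def
    by (intro order.trans[OF degree_smult_le]) simp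
qed

lemma continuous_on_Y_polar [continuous_intros]:
  "continuous_on S f \<Longrightarrow> continuous_on S (\<lambda>\<theta>. Y_polar p (f \<theta>))"
  unfolding Y_polar_def assoc_legendre_def by (intro continuous_intros)

lemma polar_integral:
  assumes "p \<in> harmonic_indices A" "q \<in> harmonic_indices B" "snd p = snd q"
  shows "integral {0..pi} (\<lambda>\<theta>. complex_of_real (Y_polar p (cos \<theta>) * Y_polar q (cos \<theta>) * sin \<theta>)) =
    (if p = q then 2 else 0)"
proof -
  have "((\<lambda>\<theta>. Y_polar p (cos \<theta>) * Y_polar q (cos \<theta>) * sin \<theta>) has_integral (if p = q then 2 else 0)) {0..pi}"
    using has_integral_poly_cos[of "polar_poly (fst p) (fst q) (nat \<bar>snd p\<bar>)"] assms
    by (cases p; cases q) (auto simp: polar_poly poly_int_polar_poly harmonic_indices_def split: if_splits)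
  from integral_unique[OF has_integral_of_real[OF this, where 'b = complex]] show ?thesis
    by simp
qed

section \<open>Orthonormality for the integral\<close>

text \<open>The azimuthal integral keeps only equal frequencies, the polar one then gives 2 on the
  diagonal, and \<open>2 * 2 pi\<close> cancels the normalization.\<close>

lemma sph_inner_lincomb:
  assumes "finite A"
  defines "I \<equiv> harmonic_indices A"
  shows "sph_inner (\<lambda>\<xi>. \<Sum>p\<in>I. a p * Yp p \<xi>) (\<lambda>\<xi>. \<Sum>p\<in>I. b p * Yp p \<xi>) = (\<Sum>p\<in>I. a p * cnj (b p))"
proof -
  have fin: "finite I" using assms by simp
  \<comment> \<open>For different frequencies \<open>G p q\<close> stays unevaluated: the integrand
    is continuous but need not be a polynomial in \<open>cos \<theta>\<close> times
    \<open>sin \<theta>\<close>.\<close>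
  define G where "G p q = integral {0..pi} (\<lambda>\<theta>. complex_of_real (Y_polar p (cos \<theta>) * Y_polar q (cos \<theta>) * sin \<theta>))" for p q
  define E where "E p q \<phi> = exp (\<i> * of_int (snd p - snd q) * complex_of_real \<phi>)" for p q :: "nat \<times> int" and \<phi>
  have G: "((\<lambda>\<theta>. complex_of_real (Y_polar p (cos \<theta>) * Y_polar q (cos \<theta>) * sin \<theta>)) has_integral G p q) {0..pi}" for p q
    unfolding G_def by (intro integrable_integral integrable_continuous_real continuous_intros)
  have "integral {0..pi} (\<lambda>\<theta>. (\<Sum>p\<in>I. a p * Yp p (sph_pt \<theta> \<phi>)) * cnj (\<Sum>p\<in>I. b p * Yp p (sph_pt \<theta> \<phi>)) * of_real (sin \<theta>)) =
      (\<Sum>p\<in>I. \<Sum>q\<in>I. a p * cnj (b q) * G p q * E p q \<phi>)" for \<phi>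
  proof -
    have "((\<lambda>\<theta>. \<Sum>p\<in>I. \<Sum>q\<in>I. a p * cnj (b q) * E p q \<phi> * of_real (Y_polar p (cos \<theta>) * Y_polar q (cos \<theta>) * sin \<theta>))
        has_integral (\<Sum>p\<in>I. \<Sum>q\<in>I. a p * cnj (b q) * E p q \<phi> * G p q)) {0..pi}"
      by (intro has_integral_sum fin has_integral_mult_right G)
    also have "?this \<longleftrightarrow> ((\<lambda>\<theta>. (\<Sum>p\<in>I. a p * Yp p (sph_pt \<theta> \<phi>)) * cnj (\<Sum>p\<in>I. b p * Yp p (sph_pt \<theta> \<phi>)) * of_real (sin \<theta>))
        has_integral (\<Sum>p\<in>I. \<Sum>q\<in>I. a p * cnj (b q) * E p q \<phi> * G p q)) {0..pi}"
    proof (intro has_integral_cong)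
      fix \<theta> assume "\<theta> \<in> {0..pi}"
      then show "(\<Sum>p\<in>I. \<Sum>q\<in>I. a p * cnj (b q) * E p q \<phi> * of_real (Y_polar p (cos \<theta>) * Y_polar q (cos \<theta>) * sin \<theta>)) =
        (\<Sum>p\<in>I. a p * Yp p (sph_pt \<theta> \<phi>)) * cnj (\<Sum>p\<in>I. b p * Yp p (sph_pt \<theta> \<phi>)) * of_real (sin \<theta>)"
        unfolding E_def Y_azimuth_mult_cnj[symmetric] cnj_sum sum_product
        unfolding sum_distrib_right
        by (intro sum.cong) (simp_all add: Yp_sph_pt)
    qed
    finally show ?thesis by (subst integral_unique, assumption) (simp add: mult_ac)
  qed
  then have "sph_inner (\<lambda>\<xi>. \<Sum>p\<in>I. a p * Yp p \<xi>) (\<lambda>\<xi>. \<Sum>p\<in>I. b p * Yp p \<xi>) =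
      complex_of_real (1 / (4 * pi)) * integral {0..2 * pi} (\<lambda>\<phi>. \<Sum>p\<in>I. \<Sum>q\<in>I. a p * cnj (b q) * G p q * E p q \<phi>)"
    unfolding sph_inner_def sph_int_def by simp
  also have "((\<lambda>\<phi>. \<Sum>p\<in>I. \<Sum>q\<in>I. a p * cnj (b q) * G p q * E p q \<phi>) has_integral
      (\<Sum>p\<in>I. \<Sum>q\<in>I. a p * cnj (b q) * G p q * (if snd p - snd q = 0 then of_real (2 * pi) else 0))) {0..2 * pi}"
    unfolding E_def by (intro has_integral_sum fin has_integral_mult_right has_integral_exp_int)
  then have "integral {0..2 * pi} (\<lambda>\<phi>. \<Sum>p\<in>I. \<Sum>q\<in>I. a p * cnj (b q) * G p q * E p q \<phi>) =
      (\<Sum>p\<in>I. \<Sum>q\<in>I. a p * cnj (b q) * G p q * (if snd p - snd q = 0 then of_real (2 * pi) else 0))"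
    by (rule integral_unique)
  also have "\<dots> = (\<Sum>p\<in>I. \<Sum>q\<in>I. if p = q then a p * cnj (b q) * of_real (4 * pi) else 0)"
    using polar_integral[of _ A _ A] unfolding G_def I_def by (intro sum.cong refl) auto
  also have "\<dots> = of_real (4 * pi) * (\<Sum>p\<in>I. a p * cnj (b p))"
    using fin by (simp add: sum_distrib_left mult_ac)
  finally show ?thesis by simp
qed

section \<open>Orthonormality for the discrete inner product\<close>

lemma Yp_node:
  assumes "\<bar>lam l\<bar> \<le> 1"
  shows "Yp p (node N lam l i) = of_real (Y_polar p (lam l)) * Y_azimuth p (2 * pi * real i / (2 * real N + 1))"
  using assms unfolding node_def
  by (subst Yp_sph_pt) (auto intro!: arccos_lbound arccos_ubound simp: cos_arccos_abs)

text \<open>The sum over longitudes gives \<open>2 N + 1\<close> for equal frequencies and 0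
  otherwise; Gauss quadrature gives 2 on the diagonal. The weights divide by exactly these
  factors.\<close>

lemma disc_inner_lincomb:
  assumes roots: "lam ` {1..N} = {x. poly (legendre N) x = 0}"
  defines "I \<equiv> harmonic_indices {..<N}"
  shows "disc_inner N lam (\<lambda>\<xi>. \<Sum>p\<in>I. a p * Yp p \<xi>) (\<lambda>\<xi>. \<Sum>p\<in>I. b p * Yp p \<xi>) = (\<Sum>p\<in>I. a p * cnj (b p))"
proof -
  have fin: "finite I" by (simp add: I_def)
  have abs_lam: "\<bar>lam l\<bar> \<le> 1" if "l \<in> {1..N}" for l
    using legendre_nodes(2)[OF roots that] by auto
  have orth: "(\<Sum>l = 1..N. \<Sum>i = 0..2 * N. Yp p (node N lam l i) * cnj (Yp q (node N lam l i)) * of_real (weight N lam l i)) =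
      (if p = q then 1 else 0)" (is "?S = _") if p: "p \<in> I" and q: "q \<in> I" for p q
  proof -
    let ?k = "snd p - snd q"
    \<comment> \<open>Frequencies have modulus at most \<open>N - 1\<close>, so no nonzero
      difference is aliased to 0.\<close>
    have k: "\<bar>?k\<bar> < int (2 * N + 1)" using p q by (auto simp: I_def harmonic_indices_def)
    have "?S = (\<Sum>l = 1..N. of_real (Y_polar p (lam l) * Y_polar q (lam l) * cotes N lam l / (2 * (2 * real N + 1))) *
        (\<Sum>i = 0..2 * N. exp (\<i> * of_int ?k * complex_of_real (2 * pi * real i / real (2 * N + 1)))))"
      unfolding sum_distrib_left
    proof (intro sum.cong refl)
      fix l i assume "l \<in> {1..N}"
      note n = Yp_node[of lam l _ N i, OF abs_lam[OF this]]
      have e: "exp (\<i> * of_int ?k * complex_of_real (2 * pi * real i / real (2 * N + 1))) =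
        Y_azimuth p (2 * pi * real i / (2 * real N + 1)) * cnj (Y_azimuth q (2 * pi * real i / (2 * real N + 1)))"
        unfolding Y_azimuth_mult_cnj by (simp add: add.commute)
      show "Yp p (node N lam l i) * cnj (Yp q (node N lam l i)) * of_real (weight N lam l i) =
        of_real (Y_polar p (lam l) * Y_polar q (lam l) * cotes N lam l / (2 * (2 * real N + 1))) *
        exp (\<i> * of_int ?k * complex_of_real (2 * pi * real i / real (2 * N + 1)))"
        unfolding n e by (simp add: weight_def)
    qed
    also have "(\<Sum>i = 0..2 * N. exp (\<i> * of_int ?k * complex_of_real (2 * pi * real i / real (2 * N + 1)))) =
        (if ?k = 0 then of_nat (2 * N + 1) else 0)"
    proof -
      have "{0..2 * N} = {..<2 * N + 1}" by auto
      then show ?thesis by (simp only: sum_roots_of_unity[OF k])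
    qed
    finally have S: "?S = (\<Sum>l = 1..N. of_real (Y_polar p (lam l) * Y_polar q (lam l) * cotes N lam l / (2 * (2 * real N + 1))) *
        (if ?k = 0 then of_nat (2 * N + 1) else 0))" .
    show ?thesis
    proof (cases "?k = 0")
      case True
      let ?P = "polar_poly (fst p) (fst q) (nat \<bar>snd p\<bar>)"
      have le: "nat \<bar>snd p\<bar> \<le> fst p" "nat \<bar>snd p\<bar> \<le> fst q" "fst p < N" "fst q < N"
        using p q True by (auto simp: I_def harmonic_indices_def)
      have "of_real (Y_polar p (lam l) * Y_polar q (lam l) * cotes N lam l / (2 * (2 * real N + 1))) * of_nat (2 * N + 1) =
          complex_of_real (cotes N lam l * poly ?P (lam l) / 2)" if "l \<in> {1..N}" for l
      proof -
        have "Y_polar p (lam l) * Y_polar q (lam l) = poly ?P (lam l)"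
          using polar_poly[of "snd p" "snd q" "lam l" "fst p" "fst q"] True abs_lam[OF that] by simp
        then have "Y_polar p (lam l) * Y_polar q (lam l) * cotes N lam l / (2 * (2 * real N + 1)) * real (2 * N + 1) =
          cotes N lam l * poly ?P (lam l) / 2"
          by (simp add: divide_simps)
        from arg_cong[OF this, of complex_of_real] show ?thesis
          by (simp only: of_real_mult of_real_of_nat_eq)
      qed
      then have "?S = (\<Sum>l = 1..N. complex_of_real (cotes N lam l * poly ?P (lam l) / 2))"
        unfolding S if_P[OF True] by (intro sum.cong refl)
      also have "\<dots> = of_real ((\<Sum>l = 1..N. cotes N lam l * poly ?P (lam l)) / 2)"
        by (simp add: sum_divide_distrib)
      also have "(\<Sum>l = 1..N. cotes N lam l * poly ?P (lam l)) = poly_int ?P"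
        using degree_polar_poly[OF le(1,2)] le(3,4) by (intro gauss_quadrature[symmetric] roots) linarith
      also have "\<dots> = (if p = q then 2 else 0)"
        unfolding poly_int_polar_poly[OF le(1,2)] using True by (simp add: prod_eq_iff)
      finally show ?thesis by (cases "p = q") simp_all
    qed (use S in auto)
  qed
  have "disc_inner N lam (\<lambda>\<xi>. \<Sum>p\<in>I. a p * Yp p \<xi>) (\<lambda>\<xi>. \<Sum>p\<in>I. b p * Yp p \<xi>) =
      (\<Sum>l = 1..N. \<Sum>i = 0..2 * N. \<Sum>p\<in>I. \<Sum>q\<in>I. a p * cnj (b q) *
        (Yp p (node N lam l i) * cnj (Yp q (node N lam l i)) * of_real (weight N lam l i)))"
    unfolding disc_inner_def disc_int_def cnj_sum sum_product
    unfolding sum_distrib_right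
    by (simp add: mult_ac)
  also have "\<dots> = (\<Sum>p\<in>I. \<Sum>q\<in>I. a p * cnj (b q) * (\<Sum>l = 1..N. \<Sum>i = 0..2 * N.
        Yp p (node N lam l i) * cnj (Yp q (node N lam l i)) * of_real (weight N lam l i)))"
    unfolding sum_distrib_left
    by (subst (2) sum.swap, subst (1) sum.swap, subst (3) sum.swap, subst (2) sum.swap) (rule refl)
  also have "\<dots> = (\<Sum>p\<in>I. \<Sum>q\<in>I. a p * cnj (b q) * (if p = q then 1 else 0))"
    by (intro sum.cong refl arg_cong2[where f = "(*)"] orth)
  also have "\<dots> = (\<Sum>p\<in>I. a p * cnj (b p))"
    using fin by (simp add: if_distrib cong: if_cong)
  finally show ?thesis .
qed

section \<open>The addition theorem on the diagonal\<close>

lemma sum_symmetric_int: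
  "(\<Sum>k = - int n..int n. f (nat \<bar>k\<bar>)) = f 0 + 2 * (\<Sum>k = 1..n. f k :: real)"
proof (induction n)
  case (Suc n)
  have "{- int (Suc n)..int (Suc n)} = insert (int (Suc n)) (insert (- int (Suc n)) {- int n..int n})"
    by auto
  then have "(\<Sum>k = - int (Suc n)..int (Suc n). f (nat \<bar>k\<bar>)) =
      f (nat \<bar>int (Suc n)\<bar>) + (f (nat \<bar>- int (Suc n)\<bar>) + (\<Sum>k = - int n..int n. f (nat \<bar>k\<bar>)))"
    by (simp del: of_nat_Suc)
  with Suc show ?case by (simp del: of_nat_Suc)
qed simp

text \<open>
  By the Legendre equation the derivatives of the terms of this sum telescope, so the sum is constant; at
  \<open>x = 1\<close> only the first term survives.
\<close>

lemma sum_legendre_derivs: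
  "(poly (legendre n) x)\<^sup>2 + 2 * (\<Sum>k = 1..n. fact (n - k) / fact (n + k) *
     ((1 - x\<^sup>2) ^ k * (poly ((pderiv ^^ k) (legendre n)) x)\<^sup>2)) = 1"
proof -
  define D where "D k = (pderiv ^^ k) (legendre n)" for k
  define c :: "nat \<Rightarrow> real" where "c k = fact (n - k) / fact (n + k)" for k
  define u where "u k = [:1, 0, -1:] ^ k * (D k)\<^sup>2" for k
  define v where "v k = [:1, 0, -1:] ^ k * D k * D (Suc k)" for k
  \<comment> \<open>Splitting off one factor \<open>D (Suc k)\<close> lets
    \<open>pderiv_weighted_legendre\<close> act on the rest.\<close>
  have step: "pderiv (u (Suc k)) = v (Suc k) - smult ((real n - real k) * (real n + real k + 1)) (v k)" for k
  proof -
    have "u (Suc k) = [:1, 0, -1:] ^ Suc k * D (Suc k) * D (Suc k)"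
      by (simp add: u_def power2_eq_square mult_ac)
    moreover have "pderiv ([:1, 0, -1:] ^ Suc k * D (Suc k) * D (Suc k)) =
        [:1, 0, -1:] ^ Suc k * D (Suc k) * pderiv (D (Suc k)) -
        D (Suc k) * smult ((real n - real k) * (real n + real k + 1)) ([:1, 0, -1:] ^ k * D k)"
      unfolding D_def pderiv_mult[of "[:1, 0, -1:] ^ Suc k * _"] pderiv_weighted_legendre
      by (simp only: mult_minus_left smult_minus_left mult_minus_right diff_conv_add_uminus)
    moreover have "pderiv (D (Suc k)) = D (Suc (Suc k))" by (simp add: D_def)
    ultimately show ?thesis
      by (simp add: v_def mult_ac del: power_Suc)
  qed
  \<comment> \<open>Telescoping works because \<open>c (K+1) (n-K) (n+K+1) = c K\<close>; the start
    uses \<open>c 0 = 1\<close>.\<close>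
  have "pderiv (\<Sum>k = 1..K. smult (c k) (u k)) = smult (c K) (v K) - v 0" if "K \<le> n" for K
    using that
  proof (induction K)
    case (Suc K)
    have "n - K = Suc (n - Suc K)" using Suc.prems by simp
    then have f: "fact (n - K) = (real n - real K) * fact (n - Suc K)"
      using Suc.prems by simp
    have "c (Suc K) = fact (n - Suc K) / ((real n + real K + 1) * fact (n + K))"
      by (simp add: c_def algebra_simps)
    moreover have "real n + real K + 1 \<noteq> 0" by linarith
    ultimately have "c (Suc K) * ((real n - real K) * (real n + real K + 1)) = c K"
      unfolding c_def[of K] f by simp
    then show ?case
      using Suc step[of K] by (simp add: pderiv_add pderiv_smult smult_diff_right)
  qed (simp add: c_def)
  moreover have "v n = 0"
    using higher_pderiv_eq_0[of "legendre n" "Suc n"] by (simp add: v_def D_def degree_legendre)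
  ultimately have "pderiv (\<Sum>k = 1..n. smult (c k) (u k)) = - v 0" by simp
  \<comment> \<open>Doubling the remaining sum cancels this term.\<close>
  moreover have "pderiv (u 0) = smult 2 (v 0)"
    by (simp add: u_def v_def D_def power2_eq_square pderiv_mult flip: poly_eq_poly_eq_iff)
      (simp add: fun_eq_iff)
  ultimately have "pderiv (u 0 + smult 2 (\<Sum>k = 1..n. smult (c k) (u k))) = 0"
    by (simp add: pderiv_add pderiv_smult)
  then obtain d where "u 0 + smult 2 (\<Sum>k = 1..n. smult (c k) (u k)) = [:d:]"
    by (auto simp: pderiv_eq_0_iff elim: degree_eq_zeroE)
  then have d: "poly (u 0) y + 2 * (\<Sum>k = 1..n. c k * poly (u k) y) = d" for y
    by (auto dest!: arg_cong[where f = "\<lambda>p. poly p y"] simp: poly_sum)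
  have "(\<Sum>k = 1..n. c k * poly (u k) 1) = 0"
    by (intro sum.neutral) (simp add: u_def zero_power)
  with d[of 1] have "d = 1" by (simp add: u_def D_def poly_legendre_1)
  moreover have "poly (u k) x = (1 - x\<^sup>2) ^ k * (poly ((pderiv ^^ k) (legendre n)) x)\<^sup>2" for k
    by (simp add: u_def D_def power2_eq_square)
  ultimately show ?thesis using d[of x] by (simp add: c_def)
qed

text \<open>The exponentials have modulus 1, so the orders \<open>k\<close> and \<open>-k\<close>
  contribute equally and \<open>sum_legendre_derivs\<close> applies.\<close>

lemma sum_norm_Y: "(\<Sum>k = - int n..int n. (cmod (Y n k \<xi>))\<^sup>2) = 2 * real n + 1"
proof -
  let ?x = "cos (colat \<xi>)"
  define f where "f k = fact (n - k) / fact (n + k) *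
     ((1 - ?x\<^sup>2) ^ k * (poly ((pderiv ^^ k) (legendre n)) ?x)\<^sup>2)" for k
  have "1 - ?x\<^sup>2 \<ge> 0" by (simp add: abs_square_le_1)
  then have "(sqrt (1 - ?x\<^sup>2) ^ k)\<^sup>2 = (1 - ?x\<^sup>2) ^ k" for k
    by (metis power_commutes power_mult real_sqrt_pow2 mult.commute)
  then have "(cmod (Y n k \<xi>))\<^sup>2 = (2 * real n + 1) * f (nat \<bar>k\<bar>)" for k
    by (simp add: Y_def f_def norm_mult assoc_legendre_def power_mult_distrib norm_exp_i_times
        mult.assoc del: of_real_mult)
  then have "(\<Sum>k = - int n..int n. (cmod (Y n k \<xi>))\<^sup>2) = (2 * real n + 1) * (f 0 + 2 * (\<Sum>k = 1..n. f k))"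
    by (simp add: sum_symmetric_int[of f] flip: sum_distrib_left)
  also have "f 0 + 2 * (\<Sum>k = 1..n. f k) = 1"
    using sum_legendre_derivs[of n ?x] by (simp add: f_def)
  finally show ?thesis by simp
qed

lemma sum_norm_Yp:
  assumes "finite A"
  shows "(\<Sum>p\<in>harmonic_indices A. (cmod (Yp p \<xi>))\<^sup>2) = (\<Sum>n\<in>A. 2 * real n + 1)"
proof -
  have "(\<Sum>p\<in>harmonic_indices A. (cmod (Yp p \<xi>))\<^sup>2) = (\<Sum>n\<in>A. \<Sum>k = - int n..int n. (cmod (Y n k \<xi>))\<^sup>2)"
    unfolding harmonic_indices_def using assms by (subst sum.Sigma) (auto simp: case_prod_beta)
  then show ?thesis by (simp add: sum_norm_Y)
qed

lemma sum_odd_interval: "a \<le> b \<Longrightarrow> (\<Sum>n = a..<b. 2 * real n + 1) = (real b)\<^sup>2 - (real a)\<^sup>2"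
  by (induction rule: dec_induct) (simp_all add: power2_eq_square algebra_simps)

section \<open>Coefficients and reproducing kernels\<close>

definition harmonic_comb :: "nat set \<Rightarrow> (nat \<times> int \<Rightarrow> complex) \<Rightarrow> sphere2 \<Rightarrow> complex" where
  "harmonic_comb A a = (\<lambda>\<xi>. \<Sum>p\<in>harmonic_indices A. a p * Yp p \<xi>)"

lemma sum_apply: "(\<Sum>i\<in>I. g i) x = (\<Sum>i\<in>I. g i x :: 'b :: comm_monoid_add)"
  by (induction I rule: infinite_finite_induct) auto

text \<open>Membership in a wavelet space becomes the existence of coefficients, which reduces later
  arguments to finite sums.\<close>

lemma cspan_harmonics:
  assumes "finite A"
  shows "cspan (\<Union>n\<in>A. harmonics n) = range (harmonic_comb A)"
proof
  let ?T = "range (harmonic_comb A)"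
  have sub: "cfun.subspace ?T"
  proof (rule cfun.subspaceI)
    have "0 = harmonic_comb A (\<lambda>_. 0)" by (simp add: harmonic_comb_def fun_eq_iff)
    then show "0 \<in> ?T" by blast
  next
    fix f g assume "f \<in> ?T" "g \<in> ?T"
    then obtain a b where "f = harmonic_comb A a" "g = harmonic_comb A b" by blast
    then have "f + g = harmonic_comb A (\<lambda>p. a p + b p)"
      by (simp add: harmonic_comb_def fun_eq_iff sum.distrib distrib_right)
    then show "f + g \<in> ?T" by blast
  next
    fix c f assume "f \<in> ?T"
    then obtain a where "f = harmonic_comb A a" by blast
    then have "cfun_scale c f = harmonic_comb A (\<lambda>p. c * a p)"
      by (simp add: harmonic_comb_def cfun_scale_def fun_eq_iff sum_distrib_left mult.assoc)
    then show "cfun_scale c f \<in> ?T" by blast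
  qed
  have "Y n k \<in> ?T" if "n \<in> A" "k \<in> {- int n..int n}" for n k
  proof -
    have "(n, k) \<in> harmonic_indices A" using that by (simp add: harmonic_indices_def)
    then have "Y n k = harmonic_comb A (\<lambda>p. if p = (n, k) then 1 else 0)"
      using assms by (simp add: harmonic_comb_def fun_eq_iff if_distrib[of "\<lambda>x. x * _"] cong: if_cong)
    then show ?thesis by blast
  qed
  then have "harmonics n \<subseteq> ?T" if "n \<in> A" for n
    unfolding harmonics_def using that by (intro cfun.span_minimal sub) auto
  then show "cspan (\<Union>n\<in>A. harmonics n) \<subseteq> ?T" by (intro cfun.span_minimal sub) auto
  show "?T \<subseteq> cspan (\<Union>n\<in>A. harmonics n)"
  proof
    fix f assume "f \<in> ?T"
    then obtain a where "f = harmonic_comb A a" by blast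
    then have "f = (\<Sum>p\<in>harmonic_indices A. cfun_scale (a p) (Yp p))"
      by (simp add: harmonic_comb_def fun_eq_iff sum_apply cfun_scale_def)
    also have "\<dots> \<in> cspan (\<Union>n\<in>A. harmonics n)"
    proof (intro cfun.span_sum cfun.span_scale cfun.span_base)
      fix p assume "p \<in> harmonic_indices A"
      then have "fst p \<in> A" "Yp p \<in> harmonics (fst p)"
        by (auto simp: harmonic_indices_def harmonics_def intro!: cfun.span_base)
      then show "Yp p \<in> (\<Union>n\<in>A. harmonics n)" by blast
    qed
    finally show "f \<in> cspan (\<Union>n\<in>A. harmonics n)" .
  qed
qed

text \<open>Padding with zero coefficients brings functions with different degree ranges to a common
  index set.\<close>

lemma harmonic_comb_extend:
  assumes "A \<subseteq> B" "finite B"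
  shows "harmonic_comb A a = harmonic_comb B (\<lambda>p. if p \<in> harmonic_indices A then a p else 0)"
proof -
  have "harmonic_indices A \<subseteq> harmonic_indices B"
    using assms(1) by (auto simp: harmonic_indices_def)
  then show ?thesis using assms(2) unfolding harmonic_comb_def fun_eq_iff
    by (intro allI sum.mono_neutral_cong_left) auto
qed

lemma sum_harmonic_indices_Int:
  assumes "finite B" "A \<subseteq> B" "A' \<subseteq> B"
  shows "(\<Sum>p\<in>harmonic_indices B. (if p \<in> harmonic_indices A then a p else 0) *
      cnj (if p \<in> harmonic_indices A' then b p else 0)) =
    (\<Sum>p\<in>harmonic_indices (A \<inter> A'). a p * cnj (b p))"
  using assms by (intro sum.mono_neutral_cong_right) (auto simp: harmonic_indices_def)

lemma sph_inner_harmonic_comb: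
  assumes "finite A" "finite B"
  shows "sph_inner (harmonic_comb A a) (harmonic_comb B b) = (\<Sum>p\<in>harmonic_indices (A \<inter> B). a p * cnj (b p))"
proof -
  have "finite (A \<union> B)" using assms by simp
  then show ?thesis
    using sph_inner_lincomb[of "A \<union> B", folded harmonic_comb_def]
      sum_harmonic_indices_Int[of "A \<union> B" A B a b]
    by (simp add: harmonic_comb_extend[of A "A \<union> B"] harmonic_comb_extend[of B "A \<union> B"])
qed

lemma disc_inner_harmonic_comb:
  assumes "lam ` {1..N} = {x. poly (legendre N) x = 0}" "A \<subseteq> {..<N}" "B \<subseteq> {..<N}"
  shows "disc_inner N lam (harmonic_comb A a) (harmonic_comb B b) = (\<Sum>p\<in>harmonic_indices (A \<inter> B). a p * cnj (b p))"
  using disc_inner_lincomb[OF assms(1), folded harmonic_comb_def] assms(2,3)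
    sum_harmonic_indices_Int[of "{..<N}" A B a b]
  by (simp add: harmonic_comb_extend[of A "{..<N}"] harmonic_comb_extend[of B "{..<N}"])

lemma sph_norm_harmonic_comb:
  assumes "finite A"
  shows "(sph_norm (harmonic_comb A a))\<^sup>2 = (\<Sum>p\<in>harmonic_indices A. (cmod (a p))\<^sup>2)"
    "sph_norm (harmonic_comb A a) \<ge> 0"
proof -
  have "Re (sph_inner (harmonic_comb A a) (harmonic_comb A a)) = (\<Sum>p\<in>harmonic_indices A. (cmod (a p))\<^sup>2)"
    using assms by (simp add: sph_inner_harmonic_comb complex_norm_square[symmetric] flip: of_real_sum)
  then show "(sph_norm (harmonic_comb A a))\<^sup>2 = (\<Sum>p\<in>harmonic_indices A. (cmod (a p))\<^sup>2)"
    "sph_norm (harmonic_comb A a) \<ge> 0"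
    by (simp_all add: sph_norm_def sum_nonneg)
qed

section \<open>Reproducing kernels and point evaluation\<close>

lemma kernel_sum_eq_harmonic_comb:
  assumes "finite A"
  shows "(\<lambda>\<xi>. kernel_sum A \<xi> \<eta>) = harmonic_comb A (\<lambda>p. cnj (Yp p \<eta>))"
  unfolding kernel_sum_def harmonic_comb_def harmonic_indices_def
  using assms by (subst sum.Sigma) (auto simp: case_prod_beta)

lemma kernel_sum_cnj: "cnj (kernel_sum A \<xi> \<eta>) = kernel_sum A \<eta> \<xi>"
  by (simp add: kernel_sum_def mult.commute)

text \<open>Conjugation sends order \<open>k\<close> to \<open>-k\<close>, which only permutes the
  terms. With \<open>kernel_sum_cnj\<close> this says that the kernel is real.\<close>

lemma kernel_sum_commute: "kernel_sum A \<xi> \<eta> = kernel_sum A \<eta> \<xi>"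
  unfolding kernel_sum_def
proof (rule sum.cong[OF refl])
  fix n
  have "cnj (Y n k \<xi>) = Y n (- k) \<xi>" for k \<xi> using cnj_Yp[of "(n, k)" \<xi>] by simp
  then show "(\<Sum>k = - int n..int n. cnj (Y n k \<eta>) * Y n k \<xi>) = (\<Sum>k = - int n..int n. cnj (Y n k \<xi>) * Y n k \<eta>)"
    by (intro sum.reindex_bij_witness[of _ uminus uminus]) (auto simp: mult.commute)
qed

lemma kernel_sum_diag:
  assumes "a \<le> b"
  shows "kernel_sum {a..<b} \<xi> \<xi> = of_real ((real b)\<^sup>2 - (real a)\<^sup>2)"
proof -
  have "kernel_sum {a..<b} \<xi> \<xi> = (\<Sum>n = a..<b. \<Sum>k = - int n..int n. of_real ((cmod (Y n k \<xi>))\<^sup>2))"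
    unfolding kernel_sum_def complex_norm_square by (simp only: mult.commute)
  also have "\<dots> = of_real (\<Sum>n = a..<b. \<Sum>k = - int n..int n. (cmod (Y n k \<xi>))\<^sup>2)"
    by (simp only: of_real_sum)
  finally show ?thesis using sum_odd_interval[OF assms] by (simp only: sum_norm_Y)
qed

text \<open>The scalar \<open>c\<close> covers both the weighted frame vectors and the normalized
  kernel attaining the minimum.\<close>

lemma sph_inner_kernel:
  assumes "finite A"
  shows "sph_inner (harmonic_comb A a) (\<lambda>\<xi>. c * kernel_sum A \<xi> \<eta>) = cnj c * harmonic_comb A a \<eta>"
proof -
  have *: "(\<lambda>\<xi>. c * kernel_sum A \<xi> \<eta>) = harmonic_comb A (\<lambda>p. c * cnj (Yp p \<eta>))"
    using fun_cong[OF kernel_sum_eq_harmonic_comb[OF assms]]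
    by (simp add: harmonic_comb_def sum_distrib_left mult.assoc)
  show ?thesis
    unfolding * sph_inner_harmonic_comb[OF assms assms]
    by (simp add: harmonic_comb_def sum_distrib_left mult_ac)
qed

lemma disc_inner_kernel:
  assumes "lam ` {1..N} = {x. poly (legendre N) x = 0}" "A \<subseteq> {..<N}"
  shows "disc_inner N lam (harmonic_comb A a) (\<lambda>\<xi>. kernel_sum A \<xi> \<eta>) = harmonic_comb A a \<eta>"
proof -
  have "finite A" using assms(2) finite_subset by blast
  then show ?thesis
    unfolding kernel_sum_eq_harmonic_comb[OF \<open>finite A\<close>] disc_inner_harmonic_comb[OF assms(1,2,2)]
    by (simp add: harmonic_comb_def)
qed

text \<open>Cauchy-Schwarz for the coefficients; the second factor is independent of the point by
  the diagonal addition theorem.\<close>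

lemma harmonic_comb_eval_le:
  assumes "finite A"
  shows "(cmod (harmonic_comb A a \<xi>))\<^sup>2 \<le> (sph_norm (harmonic_comb A a))\<^sup>2 * (\<Sum>n\<in>A. 2 * real n + 1)"
proof -
  have "cmod (harmonic_comb A a \<xi>) \<le> (\<Sum>p\<in>harmonic_indices A. cmod (a p) * cmod (Yp p \<xi>))"
    unfolding harmonic_comb_def norm_mult[symmetric] by (rule norm_sum)
  then have "(cmod (harmonic_comb A a \<xi>))\<^sup>2 \<le> (\<Sum>p\<in>harmonic_indices A. cmod (a p) * cmod (Yp p \<xi>))\<^sup>2"
    by (intro power_mono) auto
  also have "\<dots> \<le> (\<Sum>p\<in>harmonic_indices A. (cmod (a p))\<^sup>2) * (\<Sum>p\<in>harmonic_indices A. (cmod (Yp p \<xi>))\<^sup>2)"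
    by (rule Cauchy_Schwarz_ineq_sum)
  finally show ?thesis using assms by (simp add: sph_norm_harmonic_comb sum_norm_Yp)
qed

lemma kernel_sum_norm:
  assumes "a \<le> b"
  shows "sph_norm (\<lambda>\<xi>. kernel_sum {a..<b} \<xi> \<eta>) = sqrt ((real b)\<^sup>2 - (real a)\<^sup>2)"
  unfolding kernel_sum_eq_harmonic_comb[OF finite_atLeastLessThan]
  by (intro real_sqrt_unique[symmetric])
    (simp_all add: sph_norm_harmonic_comb sum_norm_Yp sum_odd_interval[OF assms])

section \<open>Mean values and energy at the nodes\<close>

lemma Y_0_0: "Y 0 0 \<xi> = 1"
  by (simp add: Y_def assoc_legendre_def legendre_def)

text \<open>With the constant 1 as a harmonic of degree 0, both integrals become inner products with
  it.\<close>

lemma harmonic_comb_0: "harmonic_comb {0} (\<lambda>_. 1) = (\<lambda>_. 1)"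
proof -
  have "harmonic_indices {0} = {(0, 0)}" by (auto simp: harmonic_indices_def)
  then show ?thesis by (simp add: harmonic_comb_def Y_0_0)
qed

lemma sph_int_harmonic_comb:
  assumes "finite A" "0 \<notin> A"
  shows "sph_int (harmonic_comb A a) = 0"
  using sph_inner_harmonic_comb[of A "{0}" a "\<lambda>_. 1"] assms
  by (simp add: harmonic_comb_0 sph_inner_def harmonic_indices_def[of "{}"])

lemma disc_int_harmonic_comb:
  assumes "lam ` {1..N} = {x. poly (legendre N) x = 0}" "A \<subseteq> {..<N}" "N > 0" "0 \<notin> A"
  shows "disc_int N lam (harmonic_comb A a) = 0"
  using disc_inner_harmonic_comb[of lam N A "{0}" a "\<lambda>_. 1"] assms
  by (simp add: harmonic_comb_0 disc_inner_def harmonic_indices_def[of "{}"])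

lemma weight_nonneg:
  assumes "lam ` {1..N} = {x. poly (legendre N) x = 0}" "l \<in> {1..N}"
  shows "weight N lam l i \<ge> 0"
  using cotes_nonneg[OF assms] by (simp add: weight_def)

text \<open>Both inner products give the same sum of squared coefficients.\<close>

lemma discrete_energy:
  assumes "lam ` {1..N} = {x. poly (legendre N) x = 0}" "A \<subseteq> {..<N}"
  shows "(\<Sum>l = 1..N. \<Sum>i = 0..2 * N. weight N lam l i * (cmod (harmonic_comb A a (node N lam l i)))\<^sup>2) =
    (sph_norm (harmonic_comb A a))\<^sup>2"
proof -
  have fin: "finite A" using assms(2) finite_subset by blast
  have "complex_of_real (\<Sum>l = 1..N. \<Sum>i = 0..2 * N. weight N lam l i * (cmod (harmonic_comb A a (node N lam l i)))\<^sup>2) =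
      disc_inner N lam (harmonic_comb A a) (harmonic_comb A a)"
    unfolding disc_inner_def disc_int_def of_real_sum of_real_mult complex_norm_square
    by (simp add: mult_ac)
  also have "\<dots> = complex_of_real ((sph_norm (harmonic_comb A a))\<^sup>2)"
    unfolding disc_inner_harmonic_comb[OF assms(1,2,2)] sph_norm_harmonic_comb(1)[OF fin] of_real_sum complex_norm_square
    by simp
  finally show ?thesis by (simp only: of_real_eq_iff)
qed

section \<open>Wavelet spaces, their kernels and the weighted frame\<close>

theorem theorem6p1:
  fixes N j0 j :: nat and m :: "nat \<Rightarrow> nat" and lam :: "nat \<Rightarrow> real"
  assumes N: "N \<ge> 1"
    and m_pos: "\<And>i. i \<ge> 1 \<Longrightarrow> m i > 0"
    and m_mono: "strict_mono_on {1..} m"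
    and j0: "\<And>i. 1 \<le> i \<Longrightarrow> i \<le> j0 \<Longrightarrow> m i \<le> N"
    and j: "1 \<le> j" "j + 1 \<le> j0"
    and roots: "lam ` {1..N} = {x. poly (legendre N) x = 0}"
  shows
    \<comment> \<open>1\<close>
    "(\<forall>f\<in>W m j. \<forall>l\<in>{1..N}. \<forall>i\<in>{0..2 * N}.
        sph_inner f (\<lambda>\<xi>. wavelet m j \<xi> (node N lam l i)) = f (node N lam l i) \<and>
        disc_inner N lam f (\<lambda>\<xi>. wavelet m j \<xi> (node N lam l i)) = f (node N lam l i)) \<and>
     \<comment> \<open>2\<close>
     (\<forall>l\<in>{1..N}. \<forall>i\<in>{0..2 * N}. \<forall>p\<in>{1..N}. \<forall>q\<in>{0..2 * N}. node N lam l i \<noteq> node N lam p q \<longrightarrow>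
        sph_inner (\<lambda>\<xi>. scaling_fn m j \<xi> (node N lam l i)) (\<lambda>\<xi>. wavelet m j \<xi> (node N lam p q)) = 0 \<and>
        disc_inner N lam (\<lambda>\<xi>. scaling_fn m j \<xi> (node N lam l i)) (\<lambda>\<xi>. wavelet m j \<xi> (node N lam p q)) = 0) \<and>
     \<comment> \<open>3\<close>
     (\<forall>l\<in>{1..N}. \<forall>i\<in>{0..2 * N}.
        sph_norm (\<lambda>\<xi>. wavelet m j \<xi> (node N lam l i)) = sqrt ((real (m (j + 1)))\<^sup>2 - (real (m j))\<^sup>2) \<and>
        wavelet m j (node N lam l i) (node N lam l i)
          = complex_of_real ((real (m (j + 1)))\<^sup>2 - (real (m j))\<^sup>2)) \<and>
     \<comment> \<open>4\<close>
     (\<forall>l\<in>{1..N}. \<forall>i\<in>{0..2 * N}.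
        complex_of_real (sph_norm (\<lambda>\<xi>. wavelet m j \<xi> (node N lam l i)))
            / wavelet m j (node N lam l i) (node N lam l i)
          = complex_of_real (1 / sqrt ((real (m (j + 1)))\<^sup>2 - (real (m j))\<^sup>2)) \<and>
        (\<exists>f\<in>W m j. f (node N lam l i) = 1 \<and>
            sph_norm f = 1 / sqrt ((real (m (j + 1)))\<^sup>2 - (real (m j))\<^sup>2)) \<and>
        (\<forall>f\<in>W m j. f (node N lam l i) = 1 \<longrightarrow>
            1 / sqrt ((real (m (j + 1)))\<^sup>2 - (real (m j))\<^sup>2) \<le> sph_norm f)) \<and>
     \<comment> \<open>5\<close>
     cspan {(\<lambda>\<xi>. wavelet m j \<xi> (node N lam l i)) | l i. l \<in> {1..N} \<and> i \<in> {0..2 * N}} = W m j \<and>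
     (j0 < N \<longrightarrow> (\<forall>f\<in>W m j. \<forall>\<xi>. f \<xi> = disc_inner N lam f (wavelet m j \<xi>))) \<and>
     \<comment> \<open>6\<close>
     tight_frame (W m j) ({1..N} \<times> {0..2 * N})
       (\<lambda>(l, i) \<xi>. complex_of_real (sqrt (weight N lam l i)) * wavelet m j \<xi> (node N lam l i)) \<and>
     (\<forall>f\<in>W m j. (sph_norm f)\<^sup>2 =
        (\<Sum>l = 1..N. \<Sum>i = 0..2 * N.
           weight N lam l i * (cmod (sph_inner f (\<lambda>\<xi>. wavelet m j \<xi> (node N lam l i))))\<^sup>2)) \<and>
     \<comment> \<open>7\<close>
     (j0 < N \<and> m j > 1 \<longrightarrow> (\<forall>l\<in>{1..N}. \<forall>i\<in>{0..2 * N}.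
        sph_int (\<lambda>\<xi>. wavelet m j \<xi> (node N lam l i)) = 0 \<and>
        disc_int N lam (\<lambda>\<xi>. wavelet m j \<xi> (node N lam l i)) = 0))"
proof -
  define A where "A = {m j..<m (Suc j)}"
  have lt: "m j < m (Suc j)" using j m_mono by (auto simp: strict_mono_on_def)
  have pos: "m j > 0" using j m_pos by simp
  have sq: "(real (m j))\<^sup>2 < (real (m (Suc j)))\<^sup>2" using lt by (intro power_strict_mono) auto
  define c where "c = (real (m (Suc j)))\<^sup>2 - (real (m j))\<^sup>2"
  have c: "c > 0" using sq by (simp add: c_def)
  \<comment> \<open>All degrees in \<open>A\<close> are therefore below \<open>N\<close>, where the
    discrete product is exact.\<close>
  have "m (Suc j) \<le> N" using j by (intro j0) auto
  then have AN: "A \<subseteq> {..<N}" by (auto simp: A_def)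
  have fin: "finite A" and A0: "0 \<notin> A" using pos by (simp_all add: A_def)
  have W: "W m j = range (harmonic_comb A)"
    unfolding W_def A_def by (intro cspan_harmonics) simp
  have wav: "wavelet m j = kernel_sum A" by (simp add: wavelet_def A_def)
  have scal: "scaling_fn m j = kernel_sum {0..<m j}" by (simp add: scaling_fn_def)
  have kW: "(\<lambda>\<xi>. s * kernel_sum A \<xi> \<eta>) \<in> W m j" for s \<eta>
  proof -
    have "(\<lambda>\<xi>. s * kernel_sum A \<xi> \<eta>) = harmonic_comb A (\<lambda>p. s * cnj (Yp p \<eta>))"
      using fun_cong[OF kernel_sum_eq_harmonic_comb[OF fin]]
      by (simp add: harmonic_comb_def sum_distrib_left mult.assoc)
    then show ?thesis unfolding W by blast
  qed
  have repr: "sph_inner f (\<lambda>\<xi>. s * kernel_sum A \<xi> \<eta>) = cnj s * f \<eta>" if "f \<in> W m j" for f s \<eta>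
    using that sph_inner_kernel[OF fin] unfolding W by blast
  note repr1 = repr[of _ 1, simplified]
  have drepr: "disc_inner N lam f (\<lambda>\<xi>. kernel_sum A \<xi> \<eta>) = f \<eta>" if "f \<in> W m j" for f \<eta>
    using that disc_inner_kernel[OF roots AN] unfolding W by blast
  have diag: "kernel_sum A \<eta> \<eta> = of_real c" for \<eta>
    unfolding A_def c_def using lt by (intro kernel_sum_diag) simp
  have knorm: "sph_norm (\<lambda>\<xi>. kernel_sum A \<xi> \<eta>) = sqrt c" for \<eta>
    unfolding A_def c_def using lt by (intro kernel_sum_norm) simp
  \<comment> \<open>Disjoint degree ranges leave an empty coefficient sum for either
    product.\<close>
  have disj: "{0..<m j} \<inter> A = {}" by (auto simp: A_def)
  have part2: "sph_inner (\<lambda>\<xi>. kernel_sum {0..<m j} \<xi> \<eta>) (\<lambda>\<xi>. kernel_sum A \<xi> \<eta>') = 0"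
    "disc_inner N lam (\<lambda>\<xi>. kernel_sum {0..<m j} \<xi> \<eta>) (\<lambda>\<xi>. kernel_sum A \<xi> \<eta>') = 0" for \<eta> \<eta>'
  proof -
    have "{0..<m j} \<subseteq> {..<N}" using lt \<open>m (Suc j) \<le> N\<close> by auto
    then show "sph_inner (\<lambda>\<xi>. kernel_sum {0..<m j} \<xi> \<eta>) (\<lambda>\<xi>. kernel_sum A \<xi> \<eta>') = 0"
      "disc_inner N lam (\<lambda>\<xi>. kernel_sum {0..<m j} \<xi> \<eta>) (\<lambda>\<xi>. kernel_sum A \<xi> \<eta>') = 0"
      using fin AN disj
      by (simp_all add: kernel_sum_eq_harmonic_comb sph_inner_harmonic_comb
          disc_inner_harmonic_comb[OF roots] harmonic_indices_def[of "{}"])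
  qed
  have min_attained: "\<exists>f\<in>W m j. f \<eta> = 1 \<and> sph_norm f = 1 / sqrt c" for \<eta>
  proof (intro bexI conjI)
    \<comment> \<open>The kernel divided by its diagonal value; reproducing \<open>?f\<close>
      against itself gives squared norm \<open>1 / c\<close>.\<close>
    let ?f = "\<lambda>\<xi>. of_real (1 / c) * kernel_sum A \<xi> \<eta>"
    show f: "?f \<in> W m j" by (rule kW)
    show f1: "?f \<eta> = 1" using c by (simp add: diag)
    show "sph_norm ?f = 1 / sqrt c"
      unfolding sph_norm_def repr[OF f] f1 by (simp add: real_sqrt_divide)
  qed
  have min_bound: "1 / sqrt c \<le> sph_norm f" if fW: "f \<in> W m j" and f1: "f \<eta> = 1" for f \<eta>
  proof -
    obtain a where f: "f = harmonic_comb A a" using fW unfolding W by blast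
    have "(\<Sum>n\<in>A. 2 * real n + 1) = c"
      unfolding A_def c_def using lt by (intro sum_odd_interval) simp
    then have "1 \<le> (sph_norm f)\<^sup>2 * c"
      using harmonic_comb_eval_le[OF fin, of a \<eta>] f1 by (simp add: f)
    then have "(1 / sqrt c)\<^sup>2 \<le> (sph_norm f)\<^sup>2"
      using c by (simp add: power_divide field_simps)
    then show ?thesis
      using sph_norm_harmonic_comb(2)[OF fin, of a] unfolding f by (rule power2_le_imp_le)
  qed
  have span: "cspan {(\<lambda>\<xi>. kernel_sum A \<xi> (node N lam l i)) | l i. l \<in> {1..N} \<and> i \<in> {0..2 * N}} = W m j"
    (is "cspan ?S = _")
  proof
    have "cfun.subspace (W m j)" unfolding W_def by (rule cfun.subspace_span)
    then show "cspan ?S \<subseteq> W m j" using kW[of 1] by (intro cfun.span_minimal) auto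
    show "W m j \<subseteq> cspan ?S"
    proof
      fix f assume f: "f \<in> W m j"
      \<comment> \<open>The discrete reproducing formula is itself a linear combination of kernels
        at the nodes, since conjugation swaps the kernel's arguments.\<close>
      have "f = (\<Sum>l = 1..N. \<Sum>i = 0..2 * N. cfun_scale (f (node N lam l i) * of_real (weight N lam l i))
          (\<lambda>\<xi>. kernel_sum A \<xi> (node N lam l i)))" (is "_ = ?g")
      proof
        fix \<xi>
        have "f \<xi> = disc_inner N lam f (\<lambda>\<eta>. kernel_sum A \<eta> \<xi>)" using drepr[OF f] by simp
        also have "\<dots> = ?g \<xi>"
          by (simp add: disc_inner_def disc_int_def kernel_sum_cnj sum_apply cfun_scale_def mult_ac)
        finally show "f \<xi> = ?g \<xi>" .
      qed
      also have "\<dots> \<in> cspan ?S"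
        by (intro cfun.span_sum cfun.span_scale cfun.span_base) blast
      finally show "f \<in> cspan ?S" .
    qed
  qed
  have recon: "f \<xi> = disc_inner N lam f (kernel_sum A \<xi>)" if "f \<in> W m j" for f \<xi>
    using drepr[OF that, of \<xi>] by (simp add: kernel_sum_commute[of A _ \<xi>])
  have energy: "(\<Sum>l = 1..N. \<Sum>i = 0..2 * N. weight N lam l i * (cmod (f (node N lam l i)))\<^sup>2) = (sph_norm f)\<^sup>2"
    if "f \<in> W m j" for f
    using that discrete_energy[OF roots AN] unfolding W by blast
  have frame: "tight_frame (W m j) ({1..N} \<times> {0..2 * N})
       (\<lambda>(l, i) \<xi>. complex_of_real (sqrt (weight N lam l i)) * kernel_sum A \<xi> (node N lam l i))"
    unfolding tight_frame_def
  proof (intro conjI ballI exI[of _ 1])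
    fix f assume f: "f \<in> W m j"
    \<comment> \<open>Nonnegativity lets the square root of the weight square back, so the frame
      constant is 1.\<close>
    have "(cmod (sph_inner f (\<lambda>\<xi>. complex_of_real (sqrt (weight N lam l i)) * kernel_sum A \<xi> (node N lam l i))))\<^sup>2 =
        weight N lam l i * (cmod (f (node N lam l i)))\<^sup>2" if "l \<in> {1..N}" for l i
      using weight_nonneg[OF roots that] by (simp add: repr[OF f] norm_mult power_mult_distrib)
    then show "(\<Sum>p\<in>{1..N} \<times> {0..2 * N}. (cmod (sph_inner f ((\<lambda>(l, i) \<xi>. complex_of_real (sqrt (weight N lam l i)) *
        kernel_sum A \<xi> (node N lam l i)) p)))\<^sup>2) = 1 * (sph_norm f)\<^sup>2"
      unfolding energy[OF f, symmetric] sum.cartesian_product by (auto intro!: sum.cong)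
  qed (use kW in auto)
  have mean: "sph_int (\<lambda>\<xi>. kernel_sum A \<xi> \<eta>) = 0" "disc_int N lam (\<lambda>\<xi>. kernel_sum A \<xi> \<eta>) = 0" for \<eta>
    using N A0 fin AN
    by (simp_all add: kernel_sum_eq_harmonic_comb sph_int_harmonic_comb disc_int_harmonic_comb[OF roots])
  have ratio: "complex_of_real (sqrt c) / of_real c = of_real (1 / sqrt c)"
    using c by (simp add: field_simps flip: of_real_mult of_real_divide)
  show ?thesis
    unfolding wav scal Suc_eq_plus1[symmetric] c_def[symmetric] knorm diag
    using repr1 drepr part2 min_attained min_bound span recon frame energy mean ratio
    by (intro conjI impI ballI allI; simp)
qed

end
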